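(* Fix $\varepsilon\in(0,1/2)$ and $\delta\in(0,1/3)$. Let $\mathcal{D}$ be any distribution over sketching matrices $S\in\mathbb{R}^{s\times m}$. Suppose that for every rank-$r$ matrix $A\in\mathbb{R}^{m\times n}$, $$\mathbb{P}_{S\sim\mathcal{D}}\Bigl[(1-\varepsilon)\,\sigma_i(A)\le\sigma_i(SA)\le(1+\varepsilon)\,\sigma_i(A)\ \text{ for all } i=1,\dots,r\Bigr]\ \ge\ 1-\delta.$$ Then there is an absolute constant $c_0>0$ (independent of $\varepsilon,\delta,r,s,m,n$ and $\mathcal{D}$) such that $$s\ \ge\ c_0\,\frac{r+\log(1/\delta)}{\varepsilon^2}.$$ In particular, no oblivious linear sketch with $s=o(r/\varepsilon^2)$ rows can achieve uniform $(1\pm\varepsilon)$ preservation of all singular values for every rank-$r$ matrix with constant success probability.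
   Context: $\sigma_1(M)\ge\sigma_2(M)\ge\cdots$ denote the singular values of a real matrix $M$. An oblivious linear sketch is a random matrix $S\in\mathbb{R}^{s\times m}$ drawn from a distribution $\mathcal{D}$ that is fixed independently of the input matrix $A$; it is applied as $A\mapsto SA$. Uniform $(1\pm\varepsilon)$ preservation of all singular values means that the displayed two-sided bound holds, for each fixed rank-$r$ matrix $A$, with the stated probability over $S\sim\mathcal{D}$.
   Formalization: As stated the bound fails for small m (the identity sketch with s = m = n = r is exact for every ε and δ), so both parts additionally assume m ≥ (r + log(1/δ))/ε², together with 1 ≤ r ≤ min(m, n). *)

theory Defs
  imports
    "HOL-Probability.Probability_Measure"
    "HOL-Library.Landau_Symbols"
    "Jordan_Normal_Form.Char_Poly"
    "Jordan_Normal_Form.DL_Rank"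
begin

text \<open>
  The singular values of \<open>A\<close>, in non-increasing order, are the square roots of the eigenvalues of
  \<open>A\<^sup>T A\<close>, repeated according to algebraic multiplicity. A matrix with \<open>n\<close> columns thus has exactly
  \<open>n\<close> of them (padded by zeros if it has fewer than \<open>n\<close> rows). The \<open>i\<close>-th one is counted from
  \<open>i = 1\<close>; outside \<open>{1..n}\<close> the value is \<open>0\<close>.
\<close>

definition singular_values :: "real mat \<Rightarrow> real list" where
  "singular_values A =
     rev (sorted_list_of_multiset
       (image_mset sqrt (proots (char_poly (transpose_mat A * A)))))"

definition singular_value :: "nat \<Rightarrow> real mat \<Rightarrow> real" where
  "singular_value i A =
     (if 1 \<le> i \<and> i \<le> length (singular_values A) then singular_values A ! (i - 1) else 0)"

text \<open>The Borel \<open>\<sigma>\<close>-algebra of the space of real \<open>s \<times> m\<close> matrices, generated by the entry maps.\<close>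

definition borel_mat :: "nat \<Rightarrow> nat \<Rightarrow> real mat measure" where
  "borel_mat s m = sigma (carrier_mat s m)
     {{S \<in> carrier_mat s m. S $$ (i, j) \<in> B} | i j B. i < s \<and> j < m \<and> B \<in> sets borel}"

definition preserves_singular_values :: "real \<Rightarrow> nat \<Rightarrow> real mat \<Rightarrow> real mat \<Rightarrow> bool" where
  "preserves_singular_values \<epsilon> r A S \<longleftrightarrow>
     (\<forall>i\<in>{1..r}. (1 - \<epsilon>) * singular_value i A \<le> singular_value i (S * A) \<and>
                 singular_value i (S * A) \<le> (1 + \<epsilon>) * singular_value i A)"

text \<open>
  The distribution \<open>D\<close> is fixed before the input \<open>A\<close>, and the probability bound is for each fixed
  \<open>A\<close> separately. The first argument of \<open>vec_space.rank\<close> is the number of rows.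
\<close>

definition oblivious_sketch ::
    "real \<Rightarrow> real \<Rightarrow> nat \<Rightarrow> nat \<Rightarrow> nat \<Rightarrow> nat \<Rightarrow> real mat measure \<Rightarrow> bool" where
  "oblivious_sketch \<epsilon> \<delta> r s m n D \<longleftrightarrow>
     prob_space D \<and> sets D = sets (borel_mat s m) \<and>
     (\<forall>A \<in> carrier_mat m n. vec_space.rank m A = r \<longrightarrow>
        measure D {S \<in> space D. preserves_singular_values \<epsilon> r A S} \<ge> 1 - \<delta>)"

end

theory Submission
  imports Defs "Jordan_Normal_Form.Spectral_Radius"
begin

unbundle no vec_syntax
unbundle no inner_syntax

text \<open>
  For a fixed \<open>s \<times> m\<close> matrix \<open>S\<close> let \<open>\<Gamma> = S\<^sup>T S - 1\<close>. If \<open>S\<close> nearly preserves the norms of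
  \<open>u + w\<close> and similar combinations, then \<open>u\<^sup>T \<Gamma> w\<close> is small; but \<open>S\<^sup>T S\<close> has rank at most
  \<open>s\<close>, which forces the Hilbert-Schmidt norm of \<open>\<Gamma>\<close> to be large when \<open>s\<close> is small, and for random
  sign vectors \<open>x, y\<close> the number \<open>x\<^sup>T \<Gamma> y\<close> is typically as large as that norm. For a single pair
  this gives only \<open>s \<ge> c / \<epsilon>\<^sup>2\<close>. The remaining factor comes from sign flips. Take \<open>b\<close> of order
  \<open>1 / \<epsilon>\<^sup>2\<close>, use only the first \<open>N = \<rho> b\<close> coordinates, and cut them into \<open>\<rho>\<close> blocks of length
  \<open>b\<close>. If the norm of \<open>x + y'\<close> is nearly preserved for every \<open>y'\<close> that arises from \<open>y\<close> by
  flipping signs of whole blocks, then aligning the signs bounds the sum of the absolute values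
  \<open>\<bar>x\<^sup>T \<Gamma> y\<^sub>j\<bar>\<close> over the blocks \<open>y\<^sub>j\<close> of \<open>y\<close> by a multiple of \<open>\<epsilon> N\<close>. The typical size of
  each term is the Hilbert-Schmidt norm \<open>\<gamma>\<^sub>j\<close> of the columns of \<open>\<Gamma>\<close> in block \<open>j\<close>. The
  trace of \<open>S\<^sup>T S\<close> over each block is at least of order \<open>b\<close> (\<open>block_energy_ge\<close>), and the inequality
  \<open>(tr H)\<^sup>2 \<le> s \<cdot> tr (H\<^sup>2)\<close> for the Gram matrix \<open>H\<close> of any set of columns of \<open>S\<close> then shows that
  \<open>\<gamma>\<^sub>j\<^sup>2 \<ge> B b\<close> for at least half of the blocks, with \<open>B\<close> as large a constant as desired, unless
  \<open>s \<ge> c N\<close>. So \<open>s < c N\<close> would give \<open>\<rho> \<surd>(B b) \<le> C \<epsilon> \<rho> b \<le> C \<rho> \<surd>b\<close>, which is false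
  for large \<open>B\<close>. This is \<open>rows_ge_of_good_tests\<close>: \<open>s \<ge> c \<rho> b\<close>.

  The flipped vectors can be tested simultaneously for two values of \<open>\<rho>\<close>.
  If \<open>\<rho> = r - 1\<close>, then \<open>x\<close> and the \<open>\<rho>\<close> blocks of \<open>y\<close> span at most \<open>r\<close> dimensions. An
  orthonormal basis of an \<open>r\<close>-dimensional space containing them, padded by zero columns, is an
  input matrix with singular values \<open>1, \<dots>, 1\<close>, and preserving these amounts to near-isometry on
  that whole space (\<open>subspace_event\<close>, \<open>rows_ge_rank\<close>).
  If \<open>\<rho>\<close> is of order \<open>ln (1 / \<delta>)\<close>, then the at most \<open>4\<^bsup>\<rho> - 1\<^esup>\<close> test vectors fail with
  probability at most \<open>\<delta>\<close> each, and a union bound applies (\<open>rows_ge_confidence\<close>). In both cases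
  \<open>N \<le> m\<close> because \<open>m \<ge> (r + ln (1 / \<delta>)) / \<epsilon>\<^sup>2\<close>. Averaging over the random choices then
  yields one fixed \<open>S\<close> that passes the tests for at least two thirds of them
  (\<open>exists_above_average\<close>).

  One difficulty remains: the moment method shows that the bilinear form is large only with
  probability at least \<open>1/36\<close>, whereas a third of the tests may fail. Therefore \<open>70\<close>
  independent pairs \<open>(x\<^sub>i, y\<^sub>i)\<close> are combined with small integer coefficients into one test. If
  three fifths of the coefficient choices pass, then every one of the pairs satisfies the bound on
  its own (\<open>rectangle_bound\<close>). If \<open>s < c N\<close>, this has probability at most
  \<open>(35/36)\<^bsup>70\<^esup> < 1/6\<close>, too little for two thirds of all tests to pass.
\<close>

section \<open>Averages over finite sets and random signs\<close>

definition avg :: "'a set \<Rightarrow> ('a \<Rightarrow> real) \<Rightarrow> real" where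
  "avg A f = (\<Sum>a\<in>A. f a) / real (card A)"

lemma avg_const: "finite A \<Longrightarrow> A \<noteq> {} \<Longrightarrow> avg A (\<lambda>_. c) = c"
  by (simp add: avg_def)

lemma avg_cong: "(\<And>a. a \<in> A \<Longrightarrow> f a = g a) \<Longrightarrow> avg A f = avg A g"
  by (simp add: avg_def)

lemma avg_mono: "(\<And>a. a \<in> A \<Longrightarrow> f a \<le> g a) \<Longrightarrow> avg A f \<le> avg A g"
  unfolding avg_def by (intro divide_right_mono sum_mono) auto

lemma avg_add: "avg A (\<lambda>a. f a + g a) = avg A f + avg A g"
  by (simp add: avg_def sum.distrib add_divide_distrib)

lemma avg_cmult: "avg A (\<lambda>a. c * f a) = c * avg A f"
  by (simp add: avg_def sum_distrib_left)

lemma avg_diff: "avg A (\<lambda>a. f a - g a) = avg A f - avg A g"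
  by (simp add: avg_def sum_subtractf diff_divide_distrib)

lemma avg_sum: "avg A (\<lambda>a. \<Sum>j\<in>J. f j a) = (\<Sum>j\<in>J. avg A (f j))"
  unfolding avg_def by (subst sum.swap) (simp add: sum_divide_distrib)

lemma avg_nonneg: "(\<And>a. a \<in> A \<Longrightarrow> 0 \<le> f a) \<Longrightarrow> 0 \<le> avg A f"
  unfolding avg_def by (intro divide_nonneg_nonneg sum_nonneg) auto

lemma avg_Times: "avg (A \<times> B) f = avg A (\<lambda>a. avg B (\<lambda>b. f (a, b)))"
  unfolding avg_def
  by (simp add: sum.cartesian_product' sum_divide_distrib[symmetric] card_cartesian_product mult.commute)

lemma avg_Times': "avg (A \<times> B) (\<lambda>(a, b). f a b) = avg A (\<lambda>a. avg B (f a))"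
  by (simp add: avg_Times)

lemma avg_swap: "avg A (\<lambda>a. avg B (\<lambda>b. f a b)) = avg B (\<lambda>b. avg A (\<lambda>a. f a b))"
  unfolding avg_def
  by (simp add: sum_divide_distrib[symmetric] sum.swap[of _ A B] mult.commute)

text \<open>
  Resampling one coordinate: this splits off one of finitely many independent choices, and the
  independence arguments below rest on it.
\<close>

lemma avg_PiE_insert:
  assumes "i \<notin> J"
  shows "avg (Pi\<^sub>E (insert i J) (\<lambda>_. A)) f = avg (Pi\<^sub>E J (\<lambda>_. A)) (\<lambda>g. avg A (\<lambda>p. f (g(i := p))))"
proof -
  have inj: "inj_on (\<lambda>(p, g). g(i := p)) (A \<times> Pi\<^sub>E J (\<lambda>_. A))"
    using assms by (rule inj_combinator)
  have "avg (Pi\<^sub>E (insert i J) (\<lambda>_. A)) f = avg (A \<times> Pi\<^sub>E J (\<lambda>_. A)) (\<lambda>(p, g). f (g(i := p)))"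
    unfolding avg_def PiE_insert_eq card_image[OF inj] sum.reindex[OF inj]
    by (simp add: case_prod_beta' o_def)
  also have "\<dots> = avg (Pi\<^sub>E J (\<lambda>_. A)) (\<lambda>g. avg A (\<lambda>p. f (g(i := p))))"
    by (subst avg_Times') (rule avg_swap)
  finally show ?thesis .
qed

lemma avg_PiE_component:
  assumes "i \<in> I" "finite I" "finite A" "A \<noteq> {}"
  shows "avg (Pi\<^sub>E I (\<lambda>_. A)) (\<lambda>W. f (W i)) = avg A f"
proof -
  have "avg (Pi\<^sub>E (insert i (I - {i})) (\<lambda>_. A)) (\<lambda>W. f (W i)) = avg (Pi\<^sub>E (I - {i}) (\<lambda>_. A)) (\<lambda>g. avg A f)"
    by (subst avg_PiE_insert) simp_all
  also have "\<dots> = avg A f"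
    using assms by (intro avg_const finite_PiE) (auto simp: PiE_eq_empty_iff)
  finally show ?thesis using assms(1) by (simp add: insert_absorb)
qed

lemma avg_le_imp_ex_le:
  assumes "\<theta> \<le> avg A f" "finite A" "A \<noteq> {}"
  shows "\<exists>a\<in>A. \<theta> \<le> f a"
proof (rule ccontr)
  assume "\<not> ?thesis"
  hence "sum f A < (\<Sum>a\<in>A. \<theta>)" using assms(2,3) by (intro sum_strict_mono) auto
  hence "avg A f < \<theta>" using assms(2,3) by (simp add: avg_def field_simps card_gt_0_iff)
  thus False using assms(1) by simp
qed

lemma avg_Cauchy_Schwarz:
  assumes "avg A (\<lambda>a. (f a)\<^sup>2) \<le> p\<^sup>2" "avg A (\<lambda>a. (g a)\<^sup>2) \<le> q\<^sup>2" "0 \<le> p" "0 \<le> q"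
  shows "avg A (\<lambda>a. f a * g a) \<le> p * q"
proof -
  have "(\<Sum>a\<in>A. f a * g a)\<^sup>2 \<le> (\<Sum>a\<in>A. (f a)\<^sup>2) * (\<Sum>a\<in>A. (g a)\<^sup>2)"
    by (rule Cauchy_Schwarz_ineq_sum)
  hence "(avg A (\<lambda>a. f a * g a))\<^sup>2 \<le> avg A (\<lambda>a. (f a)\<^sup>2) * avg A (\<lambda>a. (g a)\<^sup>2)"
    unfolding avg_def by (simp add: power_divide power2_eq_square divide_right_mono)
  also have "\<dots> \<le> p\<^sup>2 * q\<^sup>2"
    by (intro mult_mono assms avg_nonneg) auto
  finally have "(avg A (\<lambda>a. f a * g a))\<^sup>2 \<le> (p * q)\<^sup>2" by (simp add: power_mult_distrib)
  thus ?thesis using assms(3,4) by (meson abs_le_square_iff mult_nonneg_nonneg abs_le_D1 abs_of_nonneg order_trans power2_le_imp_le)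
qed

text \<open>
  The second moment method for a sum whose terms have comparable first and second moments. The
  terms may be dependent: Minkowski's inequality still bounds the second moment of the sum by
  \<open>(\<Sum> a\<^sub>j)\<^sup>2\<close>.
\<close>

lemma Paley_Zygmund_sum:
  fixes f :: "'j \<Rightarrow> 'a \<Rightarrow> real"
  assumes A: "finite A" "A \<noteq> {}"
    and nn: "\<And>j x. j \<in> J \<Longrightarrow> x \<in> A \<Longrightarrow> 0 \<le> f j x"
    and a: "\<And>j. j \<in> J \<Longrightarrow> 0 \<le> a j"
    and one: "\<And>j. j \<in> J \<Longrightarrow> a j / 3 \<le> avg A (f j)"
    and two: "\<And>j. j \<in> J \<Longrightarrow> avg A (\<lambda>x. (f j x)\<^sup>2) \<le> (a j)\<^sup>2"
  shows "1 / 36 \<le> avg A (\<lambda>x. of_bool (sum a J / 6 \<le> (\<Sum>j\<in>J. f j x)))"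
proof (cases "sum a J = 0")
  case True
  have "avg A (\<lambda>x. of_bool (sum a J / 6 \<le> (\<Sum>j\<in>J. f j x))) = avg A (\<lambda>_. 1)"
    using nn by (intro avg_cong) (auto simp: True sum_nonneg)
  thus ?thesis using A by (simp add: avg_const)
next
  case False
  define s where "s = sum a J"
  define F where "F = (\<lambda>x. \<Sum>j\<in>J. f j x)"
  define P where "P = avg A (\<lambda>x. of_bool (s / 6 \<le> F x))"
  have s: "s > 0" using False a sum_nonneg[of J a] unfolding s_def by fastforce
  have F1: "s / 3 \<le> avg A F"
    unfolding F_def s_def avg_sum sum_divide_distrib by (intro sum_mono one)
  have F2: "avg A (\<lambda>x. (F x)\<^sup>2) \<le> s\<^sup>2"
  proof -
    have "avg A (\<lambda>x. (F x)\<^sup>2) = (\<Sum>i\<in>J. \<Sum>j\<in>J. avg A (\<lambda>x. f i x * f j x))"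
      unfolding F_def power2_eq_square sum_product by (simp add: avg_sum)
    also have "\<dots> \<le> (\<Sum>i\<in>J. \<Sum>j\<in>J. a i * a j)"
      by (intro sum_mono avg_Cauchy_Schwarz two a)
    also have "\<dots> = s\<^sup>2" by (simp add: s_def power2_eq_square sum_product)
    finally show ?thesis .
  qed
  have "F x \<le> s / 6 + (F x)\<^sup>2 / (12 * s) + 3 * s * of_bool (s / 6 \<le> F x)" if "x \<in> A" for x
  proof (cases "s / 6 \<le> F x")
    case True
    \<comment> \<open>where \<open>F\<close> is large, AM-GM splits it into its square and a constant; \<open>6 s\<close> balances the two\<close>
    have "0 \<le> (F x - 6 * s)\<^sup>2" by simp
    hence "12 * s * F x \<le> (F x)\<^sup>2 + 36 * s\<^sup>2" by (simp add: power2_diff algebra_simps)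
    hence "F x \<le> ((F x)\<^sup>2 + 36 * s\<^sup>2) / (12 * s)" using s by (simp add: field_simps)
    also have "\<dots> = (F x)\<^sup>2 / (12 * s) + 3 * s" using s by (simp add: field_simps power2_eq_square)
    finally show ?thesis using True s by simp
  next
    case False
    thus ?thesis using s by (simp add: add_increasing2)
  qed
  hence "avg A F \<le> avg A (\<lambda>x. s / 6 + (F x)\<^sup>2 / (12 * s) + 3 * s * of_bool (s / 6 \<le> F x))"
    by (rule avg_mono)
  also have "\<dots> = s / 6 + avg A (\<lambda>x. (F x)\<^sup>2) / (12 * s) + 3 * s * P"
    using avg_cmult[of A "1 / (12 * s)" "\<lambda>x. (F x)\<^sup>2"] by (simp add: avg_add avg_const[OF A] avg_cmult P_def)
  also have "\<dots> \<le> s / 6 + s\<^sup>2 / (12 * s) + 3 * s * P"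
    using F2 s by (intro add_mono divide_right_mono) auto
  finally have "s / 3 \<le> s / 6 + s / 12 + 3 * s * P" using F1 s by (simp add: power2_eq_square)
  hence "s * (1 / 12) \<le> s * (3 * P)" by simp
  hence "1 / 12 \<le> 3 * P" using s by (simp only: mult_le_cancel_left_pos)
  thus ?thesis by (simp add: P_def F_def s_def)
qed

definition signs :: "nat \<Rightarrow> (nat \<Rightarrow> real) set" where
  "signs N = Pi\<^sub>E {..<N} (\<lambda>_. {-1, 1})"

lemma finite_signs: "finite (signs N)" and signs_nonempty: "signs N \<noteq> {}"
  by (auto simp: signs_def PiE_eq_empty_iff intro!: finite_PiE)

lemma avg_signs_Suc:
  "avg (signs (Suc N)) f = avg (signs N) (\<lambda>x. (f (x(N := - 1)) + f (x(N := 1))) / 2)"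
  unfolding signs_def lessThan_Suc by (subst avg_PiE_insert) (simp_all add: avg_def)

text \<open>
  Moments of the squared length of the random vector \<open>\<Sum>\<^sub>k x\<^sub>k g\<^sub>k\<close>, the \<open>g\<^sub>k\<close> being vectors
  indexed by \<open>L\<close>. Vector coefficients make one statement serve both stages of a bilinear form:
  first the outer signs (vectors), then the inner ones (scalars). The constant \<open>3\<close> is that of the
  Gaussian fourth moment, and it survives the induction since
  \<open>3 \<sigma>\<^sup>2 + 6 C \<sigma> + C\<^sup>2 \<le> 3 (\<sigma> + C)\<^sup>2\<close>.
\<close>

lemma Rademacher_moments:
  fixes g :: "nat \<Rightarrow> 'l \<Rightarrow> real"
  assumes L: "finite L"
  defines "q \<equiv> (\<lambda>N x. \<Sum>l\<in>L. (\<Sum>k<N. x k * g k l)\<^sup>2)"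
    and "\<sigma> \<equiv> (\<lambda>N::nat. \<Sum>k<N. \<Sum>l\<in>L. (g k l)\<^sup>2)"
  shows "avg (signs N) (q N) = \<sigma> N \<and> avg (signs N) (\<lambda>x. (q N x)\<^sup>2) \<le> 3 * (\<sigma> N)\<^sup>2"
proof (induction N)
  case 0
  show ?case by (simp add: q_def \<sigma>_def signs_def avg_def)
next
  case (Suc N)
  define C where "C = (\<Sum>l\<in>L. (g N l)\<^sup>2)"
  define c where "c = (\<lambda>x. \<Sum>l\<in>L. (\<Sum>k<N. x k * g k l) * g N l)"
  have \<sigma>: "\<sigma> (Suc N) = \<sigma> N + C" by (simp add: \<sigma>_def C_def)
  have \<sigma>0: "0 \<le> \<sigma> N" and C0: "0 \<le> C" by (auto simp: \<sigma>_def C_def intro!: sum_nonneg)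
  have upd: "(\<Sum>k<N. (x(N := e)) k * g k l) = (\<Sum>k<N. x k * g k l)" for x l and e :: real
    by (intro sum.cong) auto
  have qs: "q (Suc N) (x(N := e)) = q N x + 2 * e * c x + e\<^sup>2 * C" for x e
    unfolding q_def c_def C_def
    by (simp add: upd power2_sum sum.distrib power_mult_distrib sum_distrib_left algebra_simps)
  have 1: "avg (signs (Suc N)) (q (Suc N)) = \<sigma> (Suc N)"
  proof -
    have "avg (signs (Suc N)) (q (Suc N)) = avg (signs N) (\<lambda>x. q N x + C)"
      unfolding avg_signs_Suc qs by (intro avg_cong) (simp add: field_simps)
    thus ?thesis using Suc by (simp add: \<sigma> avg_add avg_const[OF finite_signs signs_nonempty])
  qed
  have cs: "(c x)\<^sup>2 \<le> q N x * C" for x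
    unfolding c_def q_def C_def by (rule Cauchy_Schwarz_ineq_sum)
  have "avg (signs (Suc N)) (\<lambda>x. (q (Suc N) x)\<^sup>2)
      = avg (signs N) (\<lambda>x. (q N x)\<^sup>2 + (2 * C) * q N x + 4 * (c x)\<^sup>2 + C\<^sup>2)"
    unfolding avg_signs_Suc qs by (intro avg_cong) (simp add: power2_eq_square algebra_simps)
  also have "\<dots> \<le> avg (signs N) (\<lambda>x. (q N x)\<^sup>2 + (6 * C) * q N x + C\<^sup>2)"
    using cs by (intro avg_mono) (simp add: mult.commute)
  also have "\<dots> = avg (signs N) (\<lambda>x. (q N x)\<^sup>2) + 6 * C * \<sigma> N + C\<^sup>2"
    using Suc by (simp add: avg_add avg_cmult avg_const[OF finite_signs signs_nonempty])
  also have "\<dots> \<le> 3 * (\<sigma> N)\<^sup>2 + 6 * C * \<sigma> N + C\<^sup>2" using Suc by simp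
  also have "\<dots> \<le> 3 * (\<sigma> (Suc N))\<^sup>2" by (simp add: \<sigma> power2_sum)
  finally show ?case using 1 by simp
qed

section \<open>Anticoncentration of bilinear forms in random signs\<close>

text \<open>
  For random signs \<open>x\<close> and \<open>y\<close> this is a decoupled Rademacher chaos of order two.
\<close>

definition chaos :: "nat \<Rightarrow> (nat \<Rightarrow> nat \<Rightarrow> real) \<Rightarrow> nat set \<Rightarrow> (nat \<Rightarrow> real) \<Rightarrow> (nat \<Rightarrow> real) \<Rightarrow> real" where
  "chaos N G B x y = (\<Sum>l\<in>B. (\<Sum>k<N. x k * G k l) * y l)"

lemma signs_masked_moments:
  fixes h :: "nat \<Rightarrow> real"
  assumes B: "B \<subseteq> {..<N}"
  shows "avg (signs N) (\<lambda>y. (\<Sum>l\<in>B. h l * y l)\<^sup>2) = (\<Sum>l\<in>B. (h l)\<^sup>2)"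
    and "avg (signs N) (\<lambda>y. (\<Sum>l\<in>B. h l * y l) ^ 4) \<le> 3 * (\<Sum>l\<in>B. (h l)\<^sup>2)\<^sup>2"
proof -
  define g where "g = (\<lambda>(k::nat) (u::unit). if k \<in> B then h k else 0)"
  have 1: "(\<Sum>k<N. y k * g k u) = (\<Sum>l\<in>B. h l * y l)" for y u
  proof -
    have "(\<Sum>k<N. y k * g k u) = (\<Sum>k<N. if k \<in> B then h k * y k else 0)"
      by (intro sum.cong) (auto simp: g_def)
    also have "\<dots> = (\<Sum>l\<in>{..<N} \<inter> B. h l * y l)" by (simp add: sum.inter_restrict)
    finally show ?thesis using B by (simp add: Int_absorb1)
  qed
  have 2: "(\<Sum>k<N. (g k ())\<^sup>2) = (\<Sum>l\<in>B. (h l)\<^sup>2)"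
  proof -
    have "(\<Sum>k<N. (g k ())\<^sup>2) = (\<Sum>k<N. if k \<in> B then (h k)\<^sup>2 else 0)"
      by (intro sum.cong) (auto simp: g_def)
    also have "\<dots> = (\<Sum>l\<in>{..<N} \<inter> B. (h l)\<^sup>2)" by (simp add: sum.inter_restrict)
    finally show ?thesis using B by (simp add: Int_absorb1)
  qed
  note R = Rademacher_moments[of "{()}" N g]
  show "avg (signs N) (\<lambda>y. (\<Sum>l\<in>B. h l * y l)\<^sup>2) = (\<Sum>l\<in>B. (h l)\<^sup>2)"
    using R by (simp add: 1 2)
  have "((\<Sum>l\<in>B. h l * y l)\<^sup>2)\<^sup>2 = (\<Sum>l\<in>B. h l * y l) ^ 4" for y
    by (simp only: power_mult[symmetric]) simp
  thus "avg (signs N) (\<lambda>y. (\<Sum>l\<in>B. h l * y l) ^ 4) \<le> 3 * (\<Sum>l\<in>B. (h l)\<^sup>2)\<^sup>2"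
    using R by (simp add: 1 2)
qed

lemma chaos_moments:
  fixes G :: "nat \<Rightarrow> nat \<Rightarrow> real"
  assumes B: "B \<subseteq> {..<N}"
  defines "\<gamma> \<equiv> (\<Sum>l\<in>B. \<Sum>k<N. (G k l)\<^sup>2)"
  shows "avg (signs N \<times> signs N) (\<lambda>p. (chaos N G B (fst p) (snd p))\<^sup>2) = \<gamma>"
    and "avg (signs N \<times> signs N) (\<lambda>p. chaos N G B (fst p) (snd p) ^ 4) \<le> 9 * \<gamma>\<^sup>2"
proof -
  define h where "h = (\<lambda>x l. \<Sum>k<N. x k * G k l)"
  have fB: "finite B" using B finite_subset by blast
  have ch: "chaos N G B x y = (\<Sum>l\<in>B. h x l * y l)" for x y by (simp add: chaos_def h_def)
  have \<gamma>: "\<gamma> = (\<Sum>k<N. \<Sum>l\<in>B. (G k l)\<^sup>2)" unfolding \<gamma>_def by (rule sum.swap)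
  have R: "avg (signs N) (\<lambda>x. \<Sum>l\<in>B. (h x l)\<^sup>2) = \<gamma>"
    "avg (signs N) (\<lambda>x. (\<Sum>l\<in>B. (h x l)\<^sup>2)\<^sup>2) \<le> 3 * \<gamma>\<^sup>2"
    unfolding \<gamma> h_def using Rademacher_moments[OF fB, of N G] by auto
  show "avg (signs N \<times> signs N) (\<lambda>p. (chaos N G B (fst p) (snd p))\<^sup>2) = \<gamma>"
    unfolding avg_Times ch fst_conv snd_conv signs_masked_moments(1)[OF B] R ..
  have "avg (signs N \<times> signs N) (\<lambda>p. chaos N G B (fst p) (snd p) ^ 4)
     \<le> avg (signs N) (\<lambda>x. 3 * (\<Sum>l\<in>B. (h x l)\<^sup>2)\<^sup>2)"
    unfolding avg_Times ch fst_conv snd_conv by (intro avg_mono signs_masked_moments(2)[OF B])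
  also have "\<dots> \<le> 9 * \<gamma>\<^sup>2" using R(2) by (simp add: avg_cmult)
  finally show "avg (signs N \<times> signs N) (\<lambda>p. chaos N G B (fst p) (snd p) ^ 4) \<le> 9 * \<gamma>\<^sup>2" .
qed

text \<open>
  A variable whose fourth moment is controlled by its second moment cannot have a small first
  absolute moment.
\<close>

lemma avg_abs_ge_of_moments:
  fixes f :: "'a \<Rightarrow> real"
  assumes "0 \<le> a" "avg A (\<lambda>x. (f x)\<^sup>2) = a\<^sup>2" "avg A (\<lambda>x. f x ^ 4) \<le> 9 * a ^ 4"
  shows "a / 3 \<le> avg A (\<lambda>x. \<bar>f x\<bar>)"
proof (cases "a = 0")
  case True
  thus ?thesis by (simp add: avg_nonneg)
next
  case False
  hence a: "a > 0" using assms(1) by simp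
  have pt: "(27 * a\<^sup>2) * (f x)\<^sup>2 - f x ^ 4 \<le> (54 * a ^ 3) * \<bar>f x\<bar>" for x
  proof -
    define u where "u = \<bar>f x\<bar>"
    \<comment> \<open>a polynomial in \<open>u\<^sup>2\<close> below a multiple of \<open>u\<close>, touching it at \<open>u = 3 a\<close>\<close>
    have "0 \<le> u * ((u - 3 * a)\<^sup>2 * (u + 6 * a))" using a by (simp add: u_def)
    also have "\<dots> = u ^ 4 - 27 * a\<^sup>2 * u\<^sup>2 + 54 * a ^ 3 * u"
      by (simp add: power2_eq_square power3_eq_cube power4_eq_xxxx algebra_simps)
    finally have "27 * a\<^sup>2 * u\<^sup>2 - u ^ 4 \<le> 54 * a ^ 3 * u" by simp
    thus ?thesis by (simp add: u_def power_even_abs)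
  qed
  have "avg A (\<lambda>x. (27 * a\<^sup>2) * (f x)\<^sup>2 - f x ^ 4) \<le> avg A (\<lambda>x. (54 * a ^ 3) * \<bar>f x\<bar>)"
    by (intro avg_mono pt)
  hence "27 * a\<^sup>2 * a\<^sup>2 - 9 * a ^ 4 \<le> 54 * a ^ 3 * avg A (\<lambda>x. \<bar>f x\<bar>)"
    using assms(2,3) by (simp add: avg_diff avg_cmult)
  hence "(18 * a ^ 3) * a \<le> (18 * a ^ 3) * (3 * avg A (\<lambda>x. \<bar>f x\<bar>))"
    by (simp add: power2_eq_square power3_eq_cube power4_eq_xxxx)
  hence "a \<le> 3 * avg A (\<lambda>x. \<bar>f x\<bar>)" using a by (subst (asm) mult_le_cancel_left_pos) auto
  thus ?thesis by simp
qed

lemma chaos_blocks_anticoncentration: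
  fixes G :: "nat \<Rightarrow> nat \<Rightarrow> real"
  assumes B: "\<And>j. j \<in> J \<Longrightarrow> B j \<subseteq> {..<N}"
  defines "\<gamma> \<equiv> (\<lambda>j. sqrt (\<Sum>l\<in>B j. \<Sum>k<N. (G k l)\<^sup>2))"
  shows "1 / 36 \<le> avg (signs N \<times> signs N)
           (\<lambda>p. of_bool (sum \<gamma> J / 6 \<le> (\<Sum>j\<in>J. \<bar>chaos N G (B j) (fst p) (snd p)\<bar>)))"
proof -
  have \<gamma>2: "(\<gamma> j)\<^sup>2 = (\<Sum>l\<in>B j. \<Sum>k<N. (G k l)\<^sup>2)" and \<gamma>0: "0 \<le> \<gamma> j" for j
    by (auto simp: \<gamma>_def intro!: sum_nonneg)
  have one: "\<gamma> j / 3 \<le> avg (signs N \<times> signs N) (\<lambda>p. \<bar>chaos N G (B j) (fst p) (snd p)\<bar>)"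
    and two: "avg (signs N \<times> signs N) (\<lambda>p. \<bar>chaos N G (B j) (fst p) (snd p)\<bar>\<^sup>2) \<le> (\<gamma> j)\<^sup>2"
    if j: "j \<in> J" for j
  proof -
    have m: "avg (signs N \<times> signs N) (\<lambda>p. (chaos N G (B j) (fst p) (snd p))\<^sup>2) = (\<gamma> j)\<^sup>2"
      "avg (signs N \<times> signs N) (\<lambda>p. chaos N G (B j) (fst p) (snd p) ^ 4) \<le> 9 * ((\<gamma> j)\<^sup>2)\<^sup>2"
      unfolding \<gamma>2 by (fact chaos_moments[OF B[OF j]])+
    have "((\<gamma> j)\<^sup>2)\<^sup>2 = \<gamma> j ^ 4" by (simp only: power_mult[symmetric]) simp
    with m show "\<gamma> j / 3 \<le> avg (signs N \<times> signs N) (\<lambda>p. \<bar>chaos N G (B j) (fst p) (snd p)\<bar>)"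
      by (intro avg_abs_ge_of_moments \<gamma>0) simp_all
    show "avg (signs N \<times> signs N) (\<lambda>p. \<bar>chaos N G (B j) (fst p) (snd p)\<bar>\<^sup>2) \<le> (\<gamma> j)\<^sup>2"
      using m(1) by simp
  qed
  have "finite (signs N \<times> signs N)" "signs N \<times> signs N \<noteq> {}"
    using finite_signs signs_nonempty by auto
  from Paley_Zygmund_sum[OF this, of J "\<lambda>j p. \<bar>chaos N G (B j) (fst p) (snd p)\<bar>" \<gamma>, OF _ \<gamma>0 one two]
  show ?thesis by simp
qed

section \<open>Dense subsets of grids\<close>

text \<open>
  A density on a product is the average of the densities of its lines, so some line in direction
  \<open>i\<close> is at least as dense.
\<close>

lemma PiE_slice:
  assumes "finite I" "i \<in> I" "finite A" "A \<noteq> {}"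
    and "\<theta> \<le> avg (Pi\<^sub>E I (\<lambda>_. A)) (\<lambda>c. of_bool (P c))"
  shows "\<exists>g. (\<forall>p\<in>A. g(i := p) \<in> Pi\<^sub>E I (\<lambda>_. A)) \<and> \<theta> * card A \<le> card {p \<in> A. P (g(i := p))}"
proof -
  define J where "J = I - {i}"
  have I: "I = insert i J" "i \<notin> J" using assms(2) by (auto simp: J_def)
  have "\<theta> \<le> avg (Pi\<^sub>E J (\<lambda>_. A)) (\<lambda>g. avg A (\<lambda>p. of_bool (P (g(i := p)))))"
    using assms(5) unfolding I(1) by (subst (asm) avg_PiE_insert[OF I(2)])
  moreover have "finite (Pi\<^sub>E J (\<lambda>_. A))" "Pi\<^sub>E J (\<lambda>_. A) \<noteq> {}"
    using assms(1,3,4) by (auto simp: J_def PiE_eq_empty_iff intro!: finite_PiE)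
  ultimately obtain g where g: "g \<in> Pi\<^sub>E J (\<lambda>_. A)" "\<theta> \<le> avg A (\<lambda>p. of_bool (P (g(i := p))))"
    using avg_le_imp_ex_le by blast
  have "(\<Sum>p\<in>A. of_bool (P (g(i := p)))) = real (card {p \<in> A. P (g(i := p))})"
    using assms(3) by (simp add: Collect_conj_eq Int_commute)
  with g(2) assms(3,4) have "\<theta> * card A \<le> card {p \<in> A. P (g(i := p))}"
    by (simp add: avg_def field_simps card_gt_0_iff)
  moreover have "\<forall>p\<in>A. g(i := p) \<in> Pi\<^sub>E I (\<lambda>_. A)"
    using g(1) unfolding I(1) by (auto simp: PiE_fun_upd)
  ultimately show ?thesis by blast
qed

text \<open>
  The two rows hold at least \<open>12\<close> points among \<open>10\<close> columns, so they share two columns.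
\<close>

lemma dense_in_grid_imp_rectangle:
  assumes G: "G \<subseteq> {0, 1} \<times> {..<10::nat}" and card: "12 \<le> card G"
  shows "\<exists>\<tau> \<tau>'. \<tau> < \<tau>' \<and> {0, 1::nat} \<times> {\<tau>, \<tau>'} \<subseteq> G"
proof -
  define R where "R = (\<lambda>t. {\<tau>. (t, \<tau>) \<in> G})"
  have sub: "R t \<subseteq> {..<10}" for t using G by (auto simp: R_def)
  have fin: "finite (R t)" for t using sub finite_subset by blast
  have "G = Pair 0 ` R 0 \<union> Pair 1 ` R 1" using G by (auto simp: R_def)
  hence "card G \<le> card (Pair (0::nat) ` R 0) + card (Pair (1::nat) ` R 1)"
    by (simp only: card_Un_le)
  hence "card G \<le> card (R 0) + card (R 1)"
    using card_image_le[OF fin[of 0], of "Pair (0::nat)"] card_image_le[OF fin[of 1], of "Pair (1::nat)"] by linarith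
  moreover have "card (R 0) + card (R 1) = card (R 0 \<union> R 1) + card (R 0 \<inter> R 1)"
    using fin by (intro card_Un_Int)
  moreover have "card (R 0 \<union> R 1) \<le> 10"
    using card_mono[of "{..<10::nat}" "R 0 \<union> R 1"] sub by auto
  ultimately have "\<not> card (R 0 \<inter> R 1) \<le> Suc 0" using card by linarith
  then obtain a c where ac: "a \<in> R 0 \<inter> R 1" "c \<in> R 0 \<inter> R 1" "a \<noteq> c"
    using fin card_le_Suc0_iff_eq[of "R 0 \<inter> R 1"] by blast
  show ?thesis
  proof (cases "a < c")
    case True thus ?thesis using ac by (intro exI[of _ a] exI[of _ c]) (auto simp: R_def)
  next
    case False thus ?thesis using ac by (intro exI[of _ c] exI[of _ a]) (auto simp: R_def)
  qed
qed

section \<open>The defect of a matrix from an isometry\<close>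

definition gram :: "(nat \<Rightarrow> nat \<Rightarrow> real) \<Rightarrow> nat \<Rightarrow> nat \<Rightarrow> nat \<Rightarrow> real" where
  "gram S s k l = (\<Sum>i<s. S i k * S i l)"

text \<open>
  The rank of \<open>S\<^sup>T S\<close> enters only here. The Gram matrix of the columns in \<open>K\<close> has the same trace
  and the same Hilbert-Schmidt norm as the \<open>s \<times> s\<close> matrix \<open>H\<close> of inner products of the rows, and
  for the latter Cauchy-Schwarz applies to just \<open>s\<close> diagonal entries.
\<close>

lemma trace_gram_square_le:
  assumes "finite K"
  shows "(\<Sum>k\<in>K. gram S s k k)\<^sup>2 \<le> real s * (\<Sum>l\<in>K. \<Sum>k\<in>K. (gram S s k l)\<^sup>2)"
proof -
  define H where "H = (\<lambda>i j. \<Sum>k\<in>K. S i k * S j k)"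
  have "(\<Sum>k\<in>K. gram S s k k) = (\<Sum>i<s. H i i)"
    unfolding gram_def H_def by (rule sum.swap)
  hence "(\<Sum>k\<in>K. gram S s k k)\<^sup>2 \<le> real s * (\<Sum>i<s. (H i i)\<^sup>2)"
    using sum_squared_le_sum_of_squares[of "\<lambda>i. H i i" "{..<s}"] by (simp add: mult.commute)
  also have "(\<Sum>i<s. (H i i)\<^sup>2) \<le> (\<Sum>i<s. \<Sum>j<s. (H i j)\<^sup>2)"
    by (intro sum_mono member_le_sum) auto
  also have "\<dots> = (\<Sum>p\<in>{..<s} \<times> {..<s}. \<Sum>q\<in>K \<times> K. S (fst p) (snd q) * S (snd p) (snd q) * (S (fst p) (fst q) * S (snd p) (fst q)))"
    unfolding H_def power2_eq_square sum_product sum.cartesian_product' by (simp add: mult.commute)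
  also have "\<dots> = (\<Sum>q\<in>K \<times> K. \<Sum>p\<in>{..<s} \<times> {..<s}. S (fst p) (snd q) * S (snd p) (snd q) * (S (fst p) (fst q) * S (snd p) (fst q)))"
    by (rule sum.swap)
  also have "\<dots> = (\<Sum>l\<in>K. \<Sum>k\<in>K. (gram S s k l)\<^sup>2)"
    unfolding gram_def power2_eq_square sum_product sum.cartesian_product' by (simp add: mult_ac)
  finally show ?thesis by (simp add: mult_left_mono)
qed

text \<open>
  Matrices and vectors are functions here, and only the first \<open>N\<close> coordinates of a vector enter.
  This makes it easy to restrict a sketch to a part of its columns.
\<close>

definition applied :: "(nat \<Rightarrow> nat \<Rightarrow> real) \<Rightarrow> nat \<Rightarrow> (nat \<Rightarrow> real) \<Rightarrow> nat \<Rightarrow> real" where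
  "applied S N w i = (\<Sum>k<N. S i k * w k)"

definition norm2 :: "nat \<Rightarrow> (nat \<Rightarrow> real) \<Rightarrow> real" where
  "norm2 N w = (\<Sum>k<N. (w k)\<^sup>2)"

definition near_isometric :: "real \<Rightarrow> nat \<Rightarrow> (nat \<Rightarrow> nat \<Rightarrow> real) \<Rightarrow> nat \<Rightarrow> (nat \<Rightarrow> real) \<Rightarrow> bool" where
  "near_isometric \<epsilon> s S N w \<longleftrightarrow>
     (1 - \<epsilon>)\<^sup>2 * norm2 N w \<le> norm2 s (applied S N w) \<and>
     norm2 s (applied S N w) \<le> (1 + \<epsilon>)\<^sup>2 * norm2 N w"

definition defect :: "(nat \<Rightarrow> nat \<Rightarrow> real) \<Rightarrow> nat \<Rightarrow> nat \<Rightarrow> nat \<Rightarrow> real" where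
  "defect S s k l = gram S s k l - (if k = l then 1 else 0)"

lemma norm2_nonneg: "0 \<le> norm2 N w"
  by (simp add: norm2_def sum_nonneg)

lemma near_isometric_cong:
  assumes "\<And>k. k < N \<Longrightarrow> w k = w' k"
  shows "near_isometric \<epsilon> s S N w = near_isometric \<epsilon> s S N w'"
proof -
  have "norm2 N w = norm2 N w'" "applied S N w = applied S N w'"
    using assms by (auto simp: norm2_def applied_def fun_eq_iff intro!: sum.cong)
  thus ?thesis by (simp add: near_isometric_def)
qed

lemma near_isometric_defect:
  assumes "near_isometric \<epsilon> s S N w" "0 < \<epsilon>" "\<epsilon> < 1 / 2"
  shows "\<bar>norm2 s (applied S N w) - norm2 N w\<bar> \<le> 3 * \<epsilon> * norm2 N w"
    and "norm2 N w \<le> 4 * norm2 s (applied S N w)"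
proof -
  note n = norm2_nonneg[of N w]
  have a: "(1 - \<epsilon>)\<^sup>2 * norm2 N w \<le> norm2 s (applied S N w)"
    and b: "norm2 s (applied S N w) \<le> (1 + \<epsilon>)\<^sup>2 * norm2 N w"
    using assms(1) by (auto simp: near_isometric_def)
  have \<epsilon>2: "\<epsilon>\<^sup>2 \<le> \<epsilon>" using assms(2,3) by (simp add: power2_eq_square)
  have 1: "1 - 3 * \<epsilon> \<le> (1 - \<epsilon>)\<^sup>2" using assms(2) by (simp add: power2_diff)
  have 2: "(1 + \<epsilon>)\<^sup>2 \<le> 1 + 3 * \<epsilon>" using \<epsilon>2 by (simp add: power2_sum)
  have 3: "(1 / 2)\<^sup>2 \<le> (1 - \<epsilon>)\<^sup>2" using assms(2,3) by (intro power_mono) auto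
  show "\<bar>norm2 s (applied S N w) - norm2 N w\<bar> \<le> 3 * \<epsilon> * norm2 N w"
    using mult_right_mono[OF 1 n] mult_right_mono[OF 2 n] a b by (simp add: algebra_simps)
  show "norm2 N w \<le> 4 * norm2 s (applied S N w)"
    using mult_right_mono[OF 3 n] a by (simp add: power2_eq_square)
qed

lemma applied_add: "applied S N (\<lambda>k. u k + w k) i = applied S N u i + applied S N w i"
  by (simp add: applied_def sum.distrib algebra_simps)

lemma applied_cmult: "applied S N (\<lambda>k. a * w k) i = a * applied S N w i"
  by (simp add: applied_def sum_distrib_left mult_ac)

lemma chaos_defect:
  "chaos N (defect S s) {..<N} x u = (\<Sum>i<s. applied S N x i * applied S N u i) - (\<Sum>k<N. x k * u k)"
proof -
  have "(\<Sum>i<s. applied S N x i * applied S N u i) = (\<Sum>i<s. \<Sum>l<N. (\<Sum>k<N. S i k * x k) * (S i l * u l))"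
    by (simp add: applied_def sum_distrib_left)
  also have "\<dots> = (\<Sum>l<N. \<Sum>i<s. (\<Sum>k<N. S i k * x k) * (S i l * u l))"
    by (rule sum.swap)
  also have "\<dots> = (\<Sum>l<N. (\<Sum>k<N. x k * gram S s k l) * u l)"
  proof (intro sum.cong refl)
    fix l
    have "(\<Sum>i<s. (\<Sum>k<N. S i k * x k) * (S i l * u l)) = (\<Sum>i<s. \<Sum>k<N. x k * (S i k * S i l) * u l)"
      by (simp add: sum_distrib_left sum_distrib_right mult_ac)
    also have "\<dots> = (\<Sum>k<N. \<Sum>i<s. x k * (S i k * S i l) * u l)" by (rule sum.swap)
    finally show "(\<Sum>i<s. (\<Sum>k<N. S i k * x k) * (S i l * u l)) = (\<Sum>k<N. x k * gram S s k l) * u l"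
      by (simp add: gram_def sum_distrib_left sum_distrib_right)
  qed
  finally have 1: "(\<Sum>i<s. applied S N x i * applied S N u i) = (\<Sum>l<N. (\<Sum>k<N. x k * gram S s k l) * u l)" .
  have "(\<Sum>k<N. x k * defect S s k l) = (\<Sum>k<N. x k * gram S s k l) - x l" if "l < N" for l
  proof -
    have "(\<Sum>k<N. x k * defect S s k l) = (\<Sum>k<N. x k * gram S s k l) - (\<Sum>k<N. if k = l then x k else 0)"
      unfolding sum_subtractf[symmetric] by (intro sum.cong) (auto simp: defect_def algebra_simps)
    thus ?thesis using that by simp
  qed
  hence "chaos N (defect S s) {..<N} x u = (\<Sum>l<N. ((\<Sum>k<N. x k * gram S s k l) - x l) * u l)"
    unfolding chaos_def by (intro sum.cong) auto
  thus ?thesis by (simp add: 1 sum_subtractf left_diff_distrib)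
qed

text \<open>
  A mixed second difference of the quadratic form isolates its bilinear part: the terms that
  depend on \<open>x\<close> alone, on \<open>u\<close> alone or on \<open>w\<close> cancel.
\<close>

lemma four_corners:
  fixes S :: "nat \<Rightarrow> nat \<Rightarrow> real" and s N :: nat
  defines "D \<equiv> (\<lambda>w. norm2 s (applied S N w) - norm2 N w)"
  shows "D (\<lambda>k. w k + x k + \<tau>' * u k) - D (\<lambda>k. w k + \<tau>' * u k)
       - D (\<lambda>k. w k + x k + \<tau> * u k) + D (\<lambda>k. w k + \<tau> * u k)
       = 2 * (\<tau>' - \<tau>) * chaos N (defect S s) {..<N} x u"
proof -
  have corners: "norm2 M (\<lambda>k. w k + x k + \<tau>' * u k) - norm2 M (\<lambda>k. w k + \<tau>' * u k)
       - norm2 M (\<lambda>k. w k + x k + \<tau> * u k) + norm2 M (\<lambda>k. w k + \<tau> * u k)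
       = 2 * (\<tau>' - \<tau>) * (\<Sum>k<M. x k * u k)" for M and w x u :: "nat \<Rightarrow> real"
    unfolding norm2_def sum_subtractf[symmetric] sum.distrib[symmetric] sum_distrib_left
    by (intro sum.cong refl) (simp add: power2_eq_square algebra_simps)
  have im: "applied S N (\<lambda>k. w k + x k + t * u k) = (\<lambda>i. applied S N w i + applied S N x i + t * applied S N u i)"
    "applied S N (\<lambda>k. w k + t * u k) = (\<lambda>i. applied S N w i + t * applied S N u i)" for t
    by (auto simp: fun_eq_iff applied_add applied_cmult)
  show ?thesis
    unfolding D_def im chaos_defect
    using corners[of s "applied S N w" "applied S N x" "applied S N u"] corners[of N w x u]
    by (simp add: right_diff_distrib)
qed

definition block :: "nat \<Rightarrow> nat \<Rightarrow> nat set" where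
  "block b j = {j * b..<j * b + b}"

lemma block_div: "k \<in> block b j \<Longrightarrow> k div b = j"
  unfolding block_def by (intro div_nat_eqI) (auto simp: mult.commute)

lemma block_iff: "0 < b \<Longrightarrow> k \<in> block b j \<longleftrightarrow> k div b = j"
  using block_div[of k b j] mod_less_divisor[of b k] div_mult_mod_eq[of k b]
  unfolding block_def atLeastLessThan_iff by (metis add_less_cancel_left le_add1)

lemma block_subset: "j < \<rho> \<Longrightarrow> block b j \<subseteq> {..<\<rho> * b}"
proof -
  assume "j < \<rho>"
  hence "Suc j * b \<le> \<rho> * b" by (intro mult_right_mono) auto
  thus ?thesis by (auto simp: block_def)
qed

lemma finite_block: "finite (block b j)" and card_block: "card (block b j) = b"
  by (auto simp: block_def)

lemma sum_over_blocks: "(\<Sum>k<\<rho> * b. f k) = (\<Sum>j<\<rho>. \<Sum>k\<in>block b j. f k)"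
  unfolding block_def by (simp add: sum.nat_group)

lemma chaos_flip:
  "chaos N G {..<\<rho> * b} x (\<lambda>k. v (k div b) * y k) = (\<Sum>j<\<rho>. v j * chaos N G (block b j) x y)"
  unfolding chaos_def sum_over_blocks sum_distrib_left
  by (intro sum.cong refl) (simp add: block_div mult_ac)

text \<open>
  The sign of block \<open>0\<close> stays fixed. Then there is a single flip when \<open>\<rho> = 1\<close>, so that the
  union bound over flips costs nothing there and works for every \<open>\<delta> < 1/3\<close>.
\<close>

definition flips :: "nat \<Rightarrow> (nat \<Rightarrow> real) set" where
  "flips \<rho> = Pi\<^sub>E {..<\<rho>} (\<lambda>j. if j = 0 then {1} else {-1, 1})"

lemma card_flips: "0 < \<rho> \<Longrightarrow> card (flips \<rho>) = 2 ^ (\<rho> - 1)"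
proof -
  assume "0 < \<rho>"
  then obtain n where n: "\<rho> = Suc n" by (cases \<rho>) auto
  have "card (flips \<rho>) = (\<Prod>j<\<rho>. card (if j = 0 then {1::real} else {-1, 1}))"
    unfolding flips_def by (simp add: card_PiE)
  also have "\<dots> = 2 ^ n" unfolding n prod.lessThan_Suc_shift by (simp add: numeral_2_eq_2)
  finally show ?thesis by (simp add: n)
qed

text \<open>
  The best choice of signs may be multiplied by a global sign, so that fixing the sign of block
  \<open>0\<close> loses nothing.
\<close>

lemma flips_aligned:
  assumes "0 < \<rho>" "\<And>v. v \<in> flips \<rho> \<Longrightarrow> \<bar>\<Sum>j<\<rho>. v j * \<beta> j\<bar> \<le> (\<eta>::real)"
  shows "(\<Sum>j<\<rho>. \<bar>\<beta> j\<bar>) \<le> \<eta>"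
proof -
  define sg where "sg = (\<lambda>z::real. if z < 0 then -1 else (1::real))"
  define v where "v = restrict (\<lambda>j. sg (\<beta> j) * sg (\<beta> 0)) {..<\<rho>}"
  have "v \<in> flips \<rho>" by (auto simp: v_def flips_def sg_def)
  hence "\<bar>\<Sum>j<\<rho>. v j * \<beta> j\<bar> \<le> \<eta>" by (rule assms(2))
  moreover have "(\<Sum>j<\<rho>. v j * \<beta> j) = sg (\<beta> 0) * (\<Sum>j<\<rho>. \<bar>\<beta> j\<bar>)"
    unfolding sum_distrib_left by (intro sum.cong) (auto simp: v_def sg_def)
  moreover have "\<bar>sg (\<beta> 0)\<bar> = 1" by (simp add: sg_def)
  ultimately show ?thesis by (simp add: abs_mult sum_nonneg)
qed

text \<open>
  On the union \<open>K\<close> of the blocks in \<open>J\<close> let \<open>T\<close> be the trace of \<open>S\<^sup>T S\<close>. Then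
  \<open>T\<^sup>2 / s \<le> \<parallel>S\<^sup>T S\<parallel>\<^sup>2 \<le> \<parallel>\<Gamma>\<parallel>\<^sup>2 + 2 T\<close> for the Hilbert-Schmidt norms over \<open>K\<close>, and the
  bound on \<open>\<Gamma>\<close> turns the right-hand side into a multiple of \<open>T\<close>. So \<open>T\<close>, and with it the
  size of \<open>K\<close>, is at most a constant times \<open>s\<close>.
\<close>

lemma few_degenerate_blocks:
  fixes \<kappa> B :: real and b s \<rho> :: nat
  assumes b: "0 < b" and \<kappa>: "0 < \<kappa>" and B: "0 \<le> B" and J: "J \<subseteq> {..<\<rho>}"
    and tr: "\<And>j. j \<in> J \<Longrightarrow> \<kappa> * b \<le> (\<Sum>k\<in>block b j. gram S s k k)"
    and deg: "\<And>j. j \<in> J \<Longrightarrow> (\<Sum>l\<in>block b j. \<Sum>k<\<rho> * b. (defect S s k l)\<^sup>2) \<le> B * b"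
  shows "\<kappa> * b * card J \<le> s * (B / \<kappa> + 2)"
proof -
  define K where "K = (\<Union>j\<in>J. block b j)"
  have fJ: "finite J" using J finite_subset by blast
  have disj: "block b i \<inter> block b j = {}" if "i \<noteq> j" for i j
    using that by (auto dest: block_div)
  have sumK: "(\<Sum>k\<in>K. f k) = (\<Sum>j\<in>J. \<Sum>k\<in>block b j. f k)" for f :: "nat \<Rightarrow> real"
    unfolding K_def using fJ finite_block disj by (intro sum.UNION_disjoint) auto
  have fK: "finite K" unfolding K_def using fJ finite_block by auto
  have KN: "K \<subseteq> {..<\<rho> * b}" unfolding K_def using J by (intro UN_least block_subset) auto
  define T where "T = (\<Sum>k\<in>K. gram S s k k)"
  define F where "F = (\<Sum>l\<in>K. \<Sum>k\<in>K. (gram S s k l)\<^sup>2)"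
  have "(\<Sum>j\<in>J. \<kappa> * b) \<le> (\<Sum>j\<in>J. \<Sum>k\<in>block b j. gram S s k k)" by (intro sum_mono tr)
  hence T: "\<kappa> * b * card J \<le> T" by (simp add: T_def sumK mult.commute)
  have "(\<Sum>l\<in>K. \<Sum>k\<in>K. (defect S s k l)\<^sup>2) = F - 2 * T + card K"
  proof -
    have "(\<Sum>k\<in>K. (defect S s k l)\<^sup>2) = (\<Sum>k\<in>K. (gram S s k l)\<^sup>2) - 2 * gram S s l l + 1" if "l \<in> K" for l
    proof -
      have "(\<Sum>k\<in>K. (defect S s k l)\<^sup>2)
          = (\<Sum>k\<in>K. (gram S s k l)\<^sup>2 - (if k = l then 2 * gram S s k l - 1 else 0))"
        by (intro sum.cong) (auto simp: defect_def power2_diff)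
      thus ?thesis using that fK by (simp add: sum_subtractf)
    qed
    thus ?thesis by (simp add: F_def T_def sum.distrib sum_subtractf sum_distrib_left)
  qed
  moreover have "(\<Sum>l\<in>K. \<Sum>k\<in>K. (defect S s k l)\<^sup>2) \<le> (\<Sum>j\<in>J. \<Sum>l\<in>block b j. \<Sum>k<\<rho> * b. (defect S s k l)\<^sup>2)"
    unfolding sumK[of "\<lambda>l. \<Sum>k\<in>K. (defect S s k l)\<^sup>2"]
    using KN by (intro sum_mono sum_mono2) auto
  moreover have "\<dots> \<le> (\<Sum>j\<in>J. B * b)" by (intro sum_mono deg)
  ultimately have F: "F \<le> 2 * T + B * (b * card J)" by (simp add: mult_ac)
  have "b * card J \<le> T / \<kappa>" using T \<kappa> by (simp add: field_simps)
  hence "B * (b * card J) \<le> B * (T / \<kappa>)" using B by (intro mult_left_mono) auto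
  with F have F': "F \<le> (B / \<kappa> + 2) * T" by (simp add: algebra_simps)
  have T0: "0 \<le> T" by (rule order_trans[OF _ T]) (use \<kappa> in auto)
  have "T * T \<le> s * F"
    using trace_gram_square_le[OF fK, of S s] by (simp add: T_def F_def power2_eq_square)
  also have "\<dots> \<le> (s * (B / \<kappa> + 2)) * T" using F' by (simp add: mult_left_mono mult.assoc)
  finally have "T \<le> s * (B / \<kappa> + 2)"
    using T0 B \<kappa> by (cases "T = 0") (auto simp: mult_le_cancel_right)
  with T show ?thesis by simp
qed

section \<open>Test vectors\<close>

definition sign_pairs :: "nat \<Rightarrow> (nat \<Rightarrow> (nat \<Rightarrow> real) \<times> (nat \<Rightarrow> real)) set" where
  "sign_pairs N = Pi\<^sub>E {..<70} (\<lambda>_. signs N \<times> signs N)"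

text \<open>
  The pair \<open>c i = (t, \<tau>)\<close> holds the coefficients of the two vectors of pair \<open>i\<close>. Two values of
  \<open>t\<close> and ten of \<open>\<tau>\<close> are enough for a rectangle in every subset of density \<open>3/5\<close>.
\<close>

definition grid :: "(nat \<Rightarrow> nat \<times> nat) set" where
  "grid = Pi\<^sub>E {..<70} (\<lambda>_. {0, 1} \<times> {..<10})"

definition x_part :: "(nat \<Rightarrow> (nat \<Rightarrow> real) \<times> (nat \<Rightarrow> real)) \<Rightarrow> (nat \<Rightarrow> nat \<times> nat) \<Rightarrow> nat \<Rightarrow> real" where
  "x_part W c k = (\<Sum>i<70. real (fst (c i)) * fst (W i) k)"

text \<open>
  The dominating vector \<open>z\<close> keeps all coordinates of this vector away from \<open>0\<close>: the other
  terms contribute at most \<open>70 \<cdot> 9 = 630\<close> here and at most \<open>70\<close> in \<open>x_part\<close>, against \<open>770\<close>.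
\<close>

definition y_part :: "(nat \<Rightarrow> (nat \<Rightarrow> real) \<times> (nat \<Rightarrow> real)) \<Rightarrow> (nat \<Rightarrow> real) \<Rightarrow> (nat \<Rightarrow> nat \<times> nat) \<Rightarrow> nat \<Rightarrow> real" where
  "y_part W z c k = 770 * z k + (\<Sum>i<70. real (snd (c i)) * snd (W i) k)"

definition flipped_test where
  "flipped_test b W z c v k = x_part W c k + v (k div b) * y_part W z c k"

text \<open>
  Single blocks are tested as well, to bound the trace of \<open>S\<^sup>T S\<close> over each block from below.
\<close>

definition block_test where
  "block_test b W z c j k = (if k div b = j then y_part W z c k else (0::real))"

text \<open>
  For \<open>\<rho> = 1\<close> the flipped test alone already bounds the trace over the only block; leaving out
  the block test keeps the number of tests at \<open>1\<close>.
\<close>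

definition tests where
  "tests b \<rho> W z c = flipped_test b W z c ` flips \<rho> \<union> (if 2 \<le> \<rho> then block_test b W z c ` {..<\<rho>} else {})"

lemma finite_sign_pairs: "finite (sign_pairs N)" and sign_pairs_nonempty: "sign_pairs N \<noteq> {}"
  and finite_grid: "finite grid" and grid_nonempty: "grid \<noteq> {}"
  by (auto simp: sign_pairs_def grid_def finite_signs signs_nonempty PiE_eq_empty_iff lessThan_empty_iff
      intro!: finite_PiE)

lemma signs_abs: "x \<in> signs N \<Longrightarrow> k < N \<Longrightarrow> \<bar>x k\<bar> = 1"
  by (auto simp: signs_def PiE_def Pi_def abs_if)

lemma flips_abs: "v \<in> flips \<rho> \<Longrightarrow> j < \<rho> \<Longrightarrow> \<bar>v j\<bar> = 1"
  by (auto simp: flips_def PiE_def Pi_def abs_if split: if_splits)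

lemma part_bounds:
  assumes W: "W \<in> sign_pairs N" and z: "z \<in> signs N" and c: "c \<in> grid" and k: "k < N"
  shows "\<bar>x_part W c k\<bar> \<le> 70" "\<bar>y_part W z c k\<bar> \<le> 1400" "140 \<le> \<bar>y_part W z c k\<bar>"
proof -
  have Wi: "\<bar>fst (W i) k\<bar> = 1" "\<bar>snd (W i) k\<bar> = 1" if "i < 70" for i
  proof -
    have "W i \<in> signs N \<times> signs N" using W that by (auto simp: sign_pairs_def)
    thus "\<bar>fst (W i) k\<bar> = 1" "\<bar>snd (W i) k\<bar> = 1" using k by (auto intro: signs_abs)
  qed
  have ci: "fst (c i) \<le> 1" "snd (c i) \<le> 9" if "i < 70" for i
  proof -
    have "c i \<in> {0, 1} \<times> {..<10}" using c that by (auto simp: grid_def)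
    thus "fst (c i) \<le> 1" "snd (c i) \<le> 9" by auto
  qed
  have "\<bar>x_part W c k\<bar> \<le> (\<Sum>i<70. \<bar>real (fst (c i)) * fst (W i) k\<bar>)"
    unfolding x_part_def by (rule sum_abs)
  also have "\<dots> \<le> (\<Sum>i<70::nat. 1)"
    using Wi ci by (intro sum_mono) (auto simp: abs_mult)
  finally show "\<bar>x_part W c k\<bar> \<le> 70" by simp
  have "\<bar>\<Sum>i<70. real (snd (c i)) * snd (W i) k\<bar> \<le> (\<Sum>i<70. \<bar>real (snd (c i)) * snd (W i) k\<bar>)"
    by (rule sum_abs)
  also have "\<dots> \<le> (\<Sum>i<70::nat. 9)"
    using Wi ci by (intro sum_mono) (auto simp: abs_mult)
  finally have "\<bar>\<Sum>i<70. real (snd (c i)) * snd (W i) k\<bar> \<le> 630" by simp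
  moreover have "\<bar>z k\<bar> = 1" using z k by (rule signs_abs)
  ultimately show "\<bar>y_part W z c k\<bar> \<le> 1400" "140 \<le> \<bar>y_part W z c k\<bar>"
    unfolding y_part_def by linarith+
qed

text \<open>
  Fix all coefficients except those of pair \<open>i\<close>. Four passed tests at the corners of a rectangle
  of coefficients bound the bilinear form of that pair, by \<open>four_corners\<close>; and this for every
  flip, so that signs can be aligned. The constant \<open>1470 = 70 + 1400\<close> bounds the coordinates of
  the test vectors.
\<close>

lemma rectangle_bound:
  assumes \<epsilon>: "0 < \<epsilon>" "\<epsilon> < 1 / 2" and b: "0 < b" and \<rho>: "0 < \<rho>"
    and W: "W \<in> sign_pairs (\<rho> * b)" and z: "z \<in> signs (\<rho> * b)" and i: "i < 70" and \<tau>: "\<tau> < \<tau>'"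
    and corner: "\<And>p. p \<in> {0, 1} \<times> {\<tau>, \<tau>'} \<Longrightarrow> g(i := p) \<in> grid \<and>
      (\<forall>w \<in> flipped_test b W z (g(i := p)) ` flips \<rho>. near_isometric \<epsilon> s S (\<rho> * b) w)"
  shows "(\<Sum>j<\<rho>. \<bar>chaos (\<rho> * b) (defect S s) (block b j) (fst (W i)) (snd (W i))\<bar>)
    \<le> 6 * \<epsilon> * 1470\<^sup>2 * (\<rho> * b)"
proof (rule flips_aligned[OF \<rho>])
  fix v assume v: "v \<in> flips \<rho>"
  define N where "N = \<rho> * b"
  define \<eta> where "\<eta> = 3 * \<epsilon> * (1470\<^sup>2 * real N)"
  define D where "D = (\<lambda>w. norm2 s (applied S N w) - norm2 N w)"
  define x where "x = fst (W i)"
  define u where "u = (\<lambda>k. v (k div b) * snd (W i) k)"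
  define w where "w = flipped_test b W z (g(i := (0, 0))) v"
  have split: "(\<Sum>i'<70. real (h ((g(i := p)) i')) * f i') = real (h p) * f i + (\<Sum>i'\<in>{..<70} - {i}. real (h (g i')) * f i')"
    for h :: "nat \<times> nat \<Rightarrow> nat" and f p
    using i by (subst sum.remove[of _ i]) (auto intro!: sum.cong)
  have test: "flipped_test b W z (g(i := (t, \<sigma>))) v = (\<lambda>k. w k + real t * x k + real \<sigma> * u k)" for t \<sigma>
    unfolding w_def flipped_test_def x_part_def y_part_def split[where h = fst] split[where h = snd] x_def u_def
    by (rule ext) (simp add: algebra_simps)
  have small: "\<bar>D (\<lambda>k. w k + real t * x k + real \<sigma> * u k)\<bar> \<le> \<eta>" if p: "(t, \<sigma>) \<in> {0, 1} \<times> {\<tau>, \<tau>'}" for t \<sigma>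
  proof -
    let ?w = "flipped_test b W z (g(i := (t, \<sigma>))) v"
    have near: "near_isometric \<epsilon> s S N ?w" and gr: "g(i := (t, \<sigma>)) \<in> grid"
      using corner[OF p] v by (auto simp: N_def)
    have bd: "\<bar>?w k\<bar> \<le> 1470" if k: "k < N" for k
    proof -
      have "k div b < \<rho>" using k by (simp add: N_def less_mult_imp_div_less)
      hence "\<bar>v (k div b)\<bar> = 1" by (rule flips_abs[OF v])
      thus ?thesis
        using part_bounds[OF W z gr, of k] k unfolding N_def flipped_test_def
        by (intro order_trans[OF abs_triangle_ineq]) (simp add: abs_mult)
    qed
    have "norm2 N ?w \<le> (\<Sum>k<N. 1470\<^sup>2)"
      unfolding norm2_def
    proof (intro sum_mono)
      fix k assume "k \<in> {..<N}"
      hence "\<bar>?w k\<bar> \<le> \<bar>1470\<bar>" using bd by simp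
      thus "(?w k)\<^sup>2 \<le> 1470\<^sup>2" by (simp only: abs_le_square_iff)
    qed
    hence n: "norm2 N ?w \<le> 1470\<^sup>2 * real N" by simp
    have "\<bar>D ?w\<bar> \<le> 3 * \<epsilon> * norm2 N ?w"
      unfolding D_def by (rule near_isometric_defect(1)[OF near \<epsilon>])
    also have "\<dots> \<le> \<eta>" unfolding \<eta>_def using \<epsilon> n by (intro mult_left_mono) auto
    finally show ?thesis unfolding test .
  qed
  have "2 * (real \<tau>' - real \<tau>) * chaos N (defect S s) {..<N} x u
     = D (\<lambda>k. w k + x k + real \<tau>' * u k) - D (\<lambda>k. w k + real \<tau>' * u k)
       - D (\<lambda>k. w k + x k + real \<tau> * u k) + D (\<lambda>k. w k + real \<tau> * u k)"
    unfolding D_def by (rule four_corners[symmetric])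
  hence "\<bar>2 * (real \<tau>' - real \<tau>) * chaos N (defect S s) {..<N} x u\<bar> \<le> 4 * \<eta>"
    using small[of 1 \<tau>'] small[of 0 \<tau>'] small[of 1 \<tau>] small[of 0 \<tau>] by simp
  moreover have "2 * \<bar>chaos N (defect S s) {..<N} x u\<bar> \<le> \<bar>2 * (real \<tau>' - real \<tau>) * chaos N (defect S s) {..<N} x u\<bar>"
    using \<tau> by (auto simp: abs_mult intro!: mult_right_mono)
  ultimately have "\<bar>chaos N (defect S s) {..<N} x u\<bar> \<le> 2 * \<eta>" by linarith
  moreover have "chaos N (defect S s) {..<N} x u = (\<Sum>j<\<rho>. v j * chaos N (defect S s) (block b j) x (snd (W i)))"
    unfolding u_def N_def by (rule chaos_flip)
  ultimately show "\<bar>\<Sum>j<\<rho>. v j * chaos (\<rho> * b) (defect S s) (block b j) (fst (W i)) (snd (W i))\<bar>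
      \<le> 6 * \<epsilon> * 1470\<^sup>2 * (\<rho> * b)"
    by (simp add: \<eta>_def N_def x_def)
qed

lemma avg_signs_block_energy:
  assumes "j < \<rho>"
  shows "avg (signs (\<rho> * b)) (\<lambda>y. norm2 s (applied S (\<rho> * b) (\<lambda>k. if k \<in> block b j then y k else 0)))
     = (\<Sum>k\<in>block b j. gram S s k k)"
proof -
  have "avg (signs (\<rho> * b)) (\<lambda>y. norm2 s (applied S (\<rho> * b) (\<lambda>k. if k \<in> block b j then y k else 0)))
     = avg (signs (\<rho> * b)) (\<lambda>y. \<Sum>i<s. (\<Sum>k\<in>block b j. S i k * y k)\<^sup>2)"
  proof (intro avg_cong)
    fix y
    have "(\<Sum>k<\<rho> * b. S i k * (if k \<in> block b j then y k else 0)) = (\<Sum>k\<in>block b j. S i k * y k)" for i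
    proof -
      have "(\<Sum>k<\<rho> * b. S i k * (if k \<in> block b j then y k else 0)) = (\<Sum>k<\<rho> * b. if k \<in> block b j then S i k * y k else 0)"
        by (intro sum.cong) auto
      also have "\<dots> = (\<Sum>k\<in>{..<\<rho> * b} \<inter> block b j. S i k * y k)" by (simp add: sum.inter_restrict)
      finally show ?thesis using block_subset[OF assms, of b] by (simp add: Int_absorb1)
    qed
    thus "norm2 s (applied S (\<rho> * b) (\<lambda>k. if k \<in> block b j then y k else 0)) = (\<Sum>i<s. (\<Sum>k\<in>block b j. S i k * y k)\<^sup>2)"
      by (simp add: norm2_def applied_def)
  qed
  also have "\<dots> = (\<Sum>i<s. \<Sum>k\<in>block b j. (S i k)\<^sup>2)"
    using signs_masked_moments(1)[OF block_subset[OF assms]] by (simp add: avg_sum)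
  also have "\<dots> = (\<Sum>k\<in>block b j. gram S s k k)"
    unfolding gram_def power2_eq_square by (rule sum.swap)
  finally show ?thesis .
qed

text \<open>
  In two thirds of the cases \<open>S\<close> shrinks a vector of squared norm at least \<open>b\<close>, supported on
  block \<open>j\<close>, by at most a constant factor. That vector is a combination of random sign vectors
  with bounded coefficients, and the average of \<open>\<parallel>S y\<parallel>\<^sup>2\<close> over random signs \<open>y\<close> on the block is
  the trace. The two uses are \<open>\<alpha> = 0\<close> (a block test) and \<open>\<alpha> = 1\<close> (the flipped test with one
  block).
\<close>

lemma block_energy_ge:
  fixes \<alpha> :: real and S :: "nat \<Rightarrow> nat \<Rightarrow> real" and s :: nat
  assumes \<alpha>: "\<bar>\<alpha>\<bar> \<le> 1" and b: "0 < b" and j: "j < \<rho>"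
  defines "N \<equiv> \<rho> * b"
  defines "E \<equiv> (\<lambda>w. norm2 s (applied S N (\<lambda>k. if k \<in> block b j then w k else 0)))"
  assumes good: "2 / 3 \<le> avg (sign_pairs N \<times> signs N \<times> grid) (\<lambda>(W, z, c). of_bool (P W z c))"
    and lower: "\<And>W z c. W \<in> sign_pairs N \<Longrightarrow> z \<in> signs N \<Longrightarrow> c \<in> grid \<Longrightarrow> P W z c \<Longrightarrow>
       norm2 N (\<lambda>k. if k \<in> block b j then \<alpha> * x_part W c k + y_part W z c k else 0)
         \<le> 4 * E (\<lambda>k. \<alpha> * x_part W c k + y_part W z c k)"
  shows "1 / 10 ^ 8 * b \<le> (\<Sum>k\<in>block b j. gram S s k k)"
proof -
  define T where "T = (\<Sum>k\<in>block b j. gram S s k k)"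
  define \<Omega> where "\<Omega> = sign_pairs N \<times> signs N \<times> grid"
  note fin = finite_sign_pairs[of N] sign_pairs_nonempty[of N] finite_grid grid_nonempty
  have E0: "0 \<le> E w" for w by (simp add: E_def norm2_nonneg)
  have app: "applied S N (\<lambda>k. if k \<in> block b j then w k else 0) i = (\<Sum>k\<in>{..<N} \<inter> block b j. S i k * w k)" for w i
  proof -
    have "applied S N (\<lambda>k. if k \<in> block b j then w k else 0) i = (\<Sum>k<N. if k \<in> block b j then S i k * w k else 0)"
      unfolding applied_def by (intro sum.cong) auto
    thus ?thesis by (simp add: sum.inter_restrict)
  qed
  have Eadd: "E (\<lambda>k. u k + w k) \<le> 2 * E u + 2 * E w" for u w
    unfolding E_def norm2_def app sum_distrib_left sum.distrib[symmetric]
  proof (intro sum_mono)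
    fix i
    have *: "(p + q)\<^sup>2 \<le> 2 * p\<^sup>2 + 2 * q\<^sup>2" for p q :: real
      using zero_le_power2[of "p - q"] by (simp add: power2_sum power2_diff)
    show "(\<Sum>k\<in>{..<N} \<inter> block b j. S i k * (u k + w k))\<^sup>2
       \<le> 2 * (\<Sum>k\<in>{..<N} \<inter> block b j. S i k * u k)\<^sup>2 + 2 * (\<Sum>k\<in>{..<N} \<inter> block b j. S i k * w k)\<^sup>2"
      using * by (simp add: distrib_left sum.distrib)
  qed
  have Emult: "E (\<lambda>k. a * w k) = a\<^sup>2 * E w" for a w
  proof -
    have lin: "(\<Sum>k\<in>{..<N} \<inter> block b j. S i k * (a * w k)) = a * (\<Sum>k\<in>{..<N} \<inter> block b j. S i k * w k)" for i
      by (simp add: sum_distrib_left mult_ac)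
    show ?thesis unfolding E_def norm2_def app lin power_mult_distrib by (rule sum_distrib_left[symmetric])
  qed
  have Esum: "E (\<lambda>k. \<Sum>q<n. w q k) \<le> n * (\<Sum>q<n. E (w q))" for n :: nat and w
  proof -
    have "E (\<lambda>k. \<Sum>q<n. w q k) = (\<Sum>i<s. (\<Sum>q<n. \<Sum>k\<in>{..<N} \<inter> block b j. S i k * w q k)\<^sup>2)"
      unfolding E_def norm2_def app sum_distrib_left by (subst sum.swap) rule
    also have "\<dots> \<le> (\<Sum>i<s. n * (\<Sum>q<n. (\<Sum>k\<in>{..<N} \<inter> block b j. S i k * w q k)\<^sup>2))"
      using sum_squared_le_sum_of_squares[of _ "{..<n}"] by (intro sum_mono) (simp add: mult.commute)
    also have "\<dots> = n * (\<Sum>q<n. E (w q))"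
      unfolding E_def norm2_def app sum_distrib_left[symmetric] by (subst sum.swap) rule
    finally show ?thesis .
  qed
  have Esigns: "avg (signs N) E = T"
    unfolding E_def T_def N_def by (rule avg_signs_block_energy[OF j])
  have T0: "0 \<le> T" unfolding T_def gram_def by (intro sum_nonneg) auto
  \<comment> \<open>the coefficients are generous upper bounds for those produced by \<open>(p + q)\<^sup>2 \<le> 2 p\<^sup>2 + 2 q\<^sup>2\<close> and Cauchy-Schwarz over the \<open>70\<close> pairs\<close>
  have pt: "of_bool (P W z c) * (b / 4) \<le> 280 * (\<Sum>i<70. E (fst (W i))) + 2371600 * E z + 22680 * (\<Sum>i<70. E (snd (W i)))"
    if W: "W \<in> sign_pairs N" and z: "z \<in> signs N" and c: "c \<in> grid" for W z c
  proof (cases "P W z c")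
    case True
    let ?w = "\<lambda>k. \<alpha> * x_part W c k + y_part W z c k"
    have ci: "fst (c i) \<le> 1" "snd (c i) \<le> 9" if "i < 70" for i
    proof -
      have "c i \<in> {0, 1} \<times> {..<10}" using c that by (auto simp: grid_def)
      thus "fst (c i) \<le> 1" "snd (c i) \<le> 9" by auto
    qed
    have "b \<le> norm2 N (\<lambda>k. if k \<in> block b j then ?w k else 0)"
    proof -
      have "(\<Sum>k<N. if k \<in> block b j then 1 else 0) = real (card ({..<N} \<inter> block b j))"
        by (simp add: sum.If_cases)
      hence "real b = (\<Sum>k<N. if k \<in> block b j then 1 else 0)"
        using block_subset[OF j, of b] by (simp add: N_def Int_absorb1 card_block)
      also have "\<dots> \<le> norm2 N (\<lambda>k. if k \<in> block b j then ?w k else 0)"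
        unfolding norm2_def
      proof (intro sum_mono)
        fix k assume k: "k \<in> {..<N}"
        have "\<bar>\<alpha> * x_part W c k\<bar> \<le> 1 * 70"
          unfolding abs_mult using part_bounds(1)[OF W z c, of k] k \<alpha> by (intro mult_mono) auto
        hence "\<bar>1\<bar> \<le> \<bar>?w k\<bar>" using part_bounds(3)[OF W z c, of k] k by auto
        hence "1\<^sup>2 \<le> (?w k)\<^sup>2" by (simp only: abs_le_square_iff)
        thus "(if k \<in> block b j then 1 else 0) \<le> (if k \<in> block b j then ?w k else 0)\<^sup>2" by simp
      qed
      finally show ?thesis .
    qed
    hence "b / 4 \<le> E ?w" using lower[OF W z c True] by simp
    also have "E ?w \<le> 2 * E (\<lambda>k. \<alpha> * x_part W c k) + 2 * E (y_part W z c)" by (rule Eadd)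
    also have "E (\<lambda>k. \<alpha> * x_part W c k) \<le> 1 * E (x_part W c)"
      unfolding Emult using \<alpha> E0 by (intro mult_right_mono) (auto simp: abs_square_le_1)
    also have "E (y_part W z c) \<le> 2 * E (\<lambda>k. 770 * z k) + 2 * E (\<lambda>k. \<Sum>i<70. real (snd (c i)) * snd (W i) k)"
      unfolding y_part_def by (rule Eadd)
    also have "E (\<lambda>k. 770 * z k) = 592900 * E z" by (simp add: Emult)
    also have "E (\<lambda>k. \<Sum>i<70. real (snd (c i)) * snd (W i) k) \<le> 70 * (\<Sum>i<70. 81 * E (snd (W i)))"
    proof -
      have "E (\<lambda>k. \<Sum>i<70. real (snd (c i)) * snd (W i) k) \<le> real 70 * (\<Sum>i<70. E (\<lambda>k. real (snd (c i)) * snd (W i) k))"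
        by (rule Esum)
      also have "\<dots> \<le> real 70 * (\<Sum>i<70. 81 * E (snd (W i)))"
      proof (intro mult_left_mono sum_mono)
        fix i :: nat assume "i \<in> {..<70}"
        hence "(real (snd (c i)))\<^sup>2 \<le> 9\<^sup>2" using ci by (intro power_mono) auto
        thus "E (\<lambda>k. real (snd (c i)) * snd (W i) k) \<le> 81 * E (snd (W i))"
          unfolding Emult by (intro mult_right_mono E0) simp
      qed simp
      finally show ?thesis by simp
    qed
    also have "E (x_part W c) \<le> 70 * (\<Sum>i<70. E (fst (W i)))"
    proof -
      have "E (x_part W c) \<le> real 70 * (\<Sum>i<70. E (\<lambda>k. real (fst (c i)) * fst (W i) k))"
        unfolding x_part_def by (rule Esum)
      also have "\<dots> \<le> real 70 * (\<Sum>i<70. E (fst (W i)))"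
      proof (intro mult_left_mono sum_mono)
        fix i :: nat assume "i \<in> {..<70}"
        hence "(real (fst (c i)))\<^sup>2 \<le> 1\<^sup>2" using ci by (intro power_mono) auto
        hence "(real (fst (c i)))\<^sup>2 * E (fst (W i)) \<le> 1 * E (fst (W i))" by (intro mult_right_mono E0) simp
        thus "E (\<lambda>k. real (fst (c i)) * fst (W i) k) \<le> E (fst (W i))" unfolding Emult by simp
      qed simp
      finally show ?thesis by simp
    qed
    finally have "b / 4 \<le> 2 * (1 * (70 * (\<Sum>i<70. E (fst (W i))))) +
       2 * (2 * (592900 * E z) + 2 * (70 * (\<Sum>i<70. 81 * E (snd (W i)))))" by simp
    moreover have "0 \<le> (\<Sum>i<70. E (fst (W i)))" by (intro sum_nonneg E0)
    ultimately show ?thesis using True by (simp add: sum_distrib_left[symmetric])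
  next
    case False
    thus ?thesis by (simp add: E0 sum_nonneg)
  qed
  have comp: "avg (sign_pairs N) (\<lambda>W. E (fst (W i))) = T" "avg (sign_pairs N) (\<lambda>W. E (snd (W i))) = T" if "i < 70" for i
  proof -
    have ne: "finite (signs N \<times> signs N)" "signs N \<times> signs N \<noteq> {}" using finite_signs signs_nonempty by auto
    have "avg (sign_pairs N) (\<lambda>W. E (fst (W i))) = avg (signs N \<times> signs N) (\<lambda>p. E (fst p))"
      unfolding sign_pairs_def using that ne by (subst avg_PiE_component) auto
    also have "\<dots> = T" by (simp add: avg_Times avg_const[OF finite_signs signs_nonempty] Esigns)
    finally show "avg (sign_pairs N) (\<lambda>W. E (fst (W i))) = T" .
    have "avg (sign_pairs N) (\<lambda>W. E (snd (W i))) = avg (signs N \<times> signs N) (\<lambda>p. E (snd p))"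
      unfolding sign_pairs_def using that ne by (subst avg_PiE_component) auto
    also have "\<dots> = T" by (simp add: avg_Times avg_const[OF finite_signs signs_nonempty] Esigns)
    finally show "avg (sign_pairs N) (\<lambda>W. E (snd (W i))) = T" .
  qed
  have "2 / 3 * (b / 4) \<le> avg \<Omega> (\<lambda>(W, z, c). of_bool (P W z c)) * (b / 4)"
    using good unfolding \<Omega>_def by (intro mult_right_mono) auto
  also have "\<dots> = avg \<Omega> (\<lambda>(W, z, c). of_bool (P W z c) * (b / 4))"
    by (simp only: case_prod_beta' avg_cmult mult.commute[of _ "real b / 4"])
  also have "\<dots> \<le> avg \<Omega> (\<lambda>(W, z, c). 280 * (\<Sum>i<70. E (fst (W i))) + 2371600 * E z + 22680 * (\<Sum>i<70. E (snd (W i))))"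
    unfolding \<Omega>_def using pt by (intro avg_mono) auto
  also have "\<dots> = 280 * (70 * T) + 2371600 * T + 22680 * (70 * T)"
    unfolding \<Omega>_def avg_Times using fin comp Esigns
    by (simp add: avg_const avg_add avg_cmult avg_sum finite_signs signs_nonempty)
  finally have "b / 6 \<le> 3978800 * T" by simp
  thus ?thesis using T0 by (simp add: T_def[symmetric])
qed

section \<open>A matrix that passes the tests has many rows\<close>

lemma avg_PiE_all:
  assumes "finite I" "finite A" "A \<noteq> {}"
  shows "avg (Pi\<^sub>E I (\<lambda>_. A)) (\<lambda>W. of_bool (\<forall>i\<in>I. P (W i))) = avg A (\<lambda>a. of_bool (P a)) ^ card I"
  using assms(1)
proof (induction I rule: finite_induct)
  case empty
  show ?case by (simp add: avg_def)
next
  case (insert i I)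
  have "avg (Pi\<^sub>E (insert i I) (\<lambda>_. A)) (\<lambda>W. of_bool (\<forall>k\<in>insert i I. P (W k)))
      = avg (Pi\<^sub>E I (\<lambda>_. A)) (\<lambda>g. avg A (\<lambda>p. of_bool (\<forall>k\<in>I. P (g k)) * of_bool (P p)))"
    unfolding avg_PiE_insert[OF insert.hyps(2)]
    using insert.hyps(2) by (intro avg_cong) (auto simp: fun_upd_apply)
  also have "\<dots> = avg (Pi\<^sub>E I (\<lambda>_. A)) (\<lambda>g. avg A (\<lambda>p. of_bool (P p)) * of_bool (\<forall>k\<in>I. P (g k)))"
    by (intro avg_cong) (simp only: avg_cmult, rule mult.commute)
  also have "\<dots> = avg A (\<lambda>p. of_bool (P p)) * avg A (\<lambda>a. of_bool (P a)) ^ card I"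
    by (simp only: avg_cmult insert.IH)
  finally show ?case using insert.hyps by simp
qed

text \<open>
  The constant of \<open>block_energy_ge\<close>.
\<close>

definition energy_constant :: real where "energy_constant = 1 / 10 ^ 8"
text \<open>
  The constant \<open>B\<close>: its root must exceed \<open>72 \<cdot> 1470\<^sup>2\<close>, where \<open>72 = 6 \<cdot> 6 \<cdot> 2\<close> collects the
  factor \<open>6\<close> of \<open>rectangle_bound\<close>, the \<open>1/6\<close> of \<open>Paley_Zygmund_sum\<close> and the loss of half of
  the blocks.
\<close>

definition defect_constant :: real where "defect_constant = (73 * 1470\<^sup>2)\<^sup>2"
definition row_constant :: real where "row_constant = energy_constant / (2 * (defect_constant / energy_constant + 2))"

text \<open>
  The lower bound for one fixed matrix. If \<open>s\<close> were smaller, then half of the blocks would have a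
  large \<open>\<gamma>\<^sub>j\<close>, so that a random pair violates the conclusion of \<open>rectangle_bound\<close> with
  probability at least \<open>1/36\<close>. But at least a sixth of the \<open>70\<close>-tuples of pairs (with \<open>z\<close>) pass
  the tests for three fifths of their coefficients, and all \<open>70\<close> pairs of such a tuple satisfy
  that conclusion.
\<close>

lemma rows_ge_of_good_tests:
  fixes \<epsilon> :: real and b \<rho> s :: nat
  assumes \<epsilon>: "0 < \<epsilon>" "\<epsilon> < 1 / 2" and b: "0 < b" "b * \<epsilon>\<^sup>2 \<le> 1" and \<rho>: "0 < \<rho>"
    and good: "2 / 3 \<le> avg (sign_pairs (\<rho> * b) \<times> signs (\<rho> * b) \<times> grid)
      (\<lambda>(W, z, c). of_bool (\<forall>w\<in>tests b \<rho> W z c. near_isometric \<epsilon> s S (\<rho> * b) w))"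
  shows "row_constant * (real \<rho> * real b) \<le> real s"
proof (rule ccontr)
  assume "\<not> ?thesis"
  hence few: "\<not> row_constant * (\<rho> * b) \<le> s" by simp
  define N where "N = \<rho> * b"
  define G where "G = (\<lambda>W z c. \<forall>w\<in>tests b \<rho> W z c. near_isometric \<epsilon> s S N w)"
  define \<gamma> where "\<gamma> = (\<lambda>j. sqrt (\<Sum>l\<in>block b j. \<Sum>k<N. (defect S s k l)\<^sup>2))"
  have \<kappa>: "0 < energy_constant" and B: "0 \<le> defect_constant" by (simp_all add: energy_constant_def defect_constant_def)
  have good': "2 / 3 \<le> avg (sign_pairs N \<times> signs N \<times> grid) (\<lambda>(W, z, c). of_bool (G W z c))"
    using good by (simp add: N_def G_def)
  have energy: "energy_constant * b \<le> (\<Sum>k\<in>block b j. gram S s k k)" if j: "j < \<rho>" for j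
  proof (cases "2 \<le> \<rho>")
    case True
    show ?thesis unfolding energy_constant_def
    proof (rule block_energy_ge[where \<alpha> = 0 and P = G, OF _ b(1) j good'[unfolded N_def], folded N_def])
      fix W z c assume "W \<in> sign_pairs N" "z \<in> signs N" "c \<in> grid" and G: "G W z c"
      have "near_isometric \<epsilon> s S N (block_test b W z c j)"
        using G True j by (auto simp: G_def tests_def)
      moreover have "block_test b W z c j = (\<lambda>k. if k \<in> block b j then 0 * x_part W c k + y_part W z c k else 0)"
        by (auto simp: block_test_def block_iff[OF b(1)])
      ultimately show "norm2 N (\<lambda>k. if k \<in> block b j then 0 * x_part W c k + y_part W z c k else 0)
         \<le> 4 * norm2 s (applied S N (\<lambda>k. if k \<in> block b j then 0 * x_part W c k + y_part W z c k else 0))"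
        using near_isometric_defect(2)[OF _ \<epsilon>] by metis
    qed simp
  next
    case False
    hence \<rho>1: "\<rho> = 1" and j0: "j = 0" using \<rho> j by auto
    define v where "v = restrict (\<lambda>_. 1::real) {..<\<rho>}"
    have v: "v \<in> flips \<rho>" by (auto simp: v_def flips_def \<rho>1)
    show ?thesis unfolding energy_constant_def
    proof (rule block_energy_ge[where \<alpha> = 1 and P = G, OF _ b(1) j good'[unfolded N_def], folded N_def])
      fix W z c assume "W \<in> sign_pairs N" "z \<in> signs N" "c \<in> grid" and G: "G W z c"
      have "near_isometric \<epsilon> s S N (flipped_test b W z c v)"
        using G v by (auto simp: G_def tests_def)
      hence "near_isometric \<epsilon> s S N (\<lambda>k. if k \<in> block b j then 1 * x_part W c k + y_part W z c k else 0)"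
        by (rule iffD1[OF near_isometric_cong, rotated])
          (auto simp: N_def \<rho>1 j0 block_iff[OF b(1)] flipped_test_def v_def)
      thus "norm2 N (\<lambda>k. if k \<in> block b j then 1 * x_part W c k + y_part W z c k else 0)
         \<le> 4 * norm2 s (applied S N (\<lambda>k. if k \<in> block b j then 1 * x_part W c k + y_part W z c k else 0))"
        by (rule near_isometric_defect(2)[OF _ \<epsilon>])
    qed simp
  qed
  define P where "P = {j \<in> {..<\<rho>}. defect_constant * b < (\<Sum>l\<in>block b j. \<Sum>k<N. (defect S s k l)\<^sup>2)}"
  have half: "\<rho> / 2 \<le> card P"
  proof -
    have "energy_constant * b * card ({..<\<rho>} - P) \<le> s * (defect_constant / energy_constant + 2)"
      using energy by (intro few_degenerate_blocks[where \<rho> = \<rho>] b \<kappa> B) (auto simp: P_def N_def)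
    also have "\<dots> \<le> (row_constant * (\<rho> * b)) * (defect_constant / energy_constant + 2)"
      using few \<kappa> B by (intro mult_right_mono) auto
    also have "\<dots> = energy_constant * b * (\<rho> / 2)"
    proof -
      have "energy_constant / (2 * t) * (\<rho> * b) * t = energy_constant * b * (\<rho> / 2)" if "0 < t" for t
        using that by (simp add: field_simps)
      moreover have "0 < defect_constant / energy_constant + 2" using \<kappa> B by (intro add_nonneg_pos) auto
      ultimately show ?thesis unfolding row_constant_def .
    qed
    finally have "card ({..<\<rho>} - P) \<le> \<rho> / 2" using \<kappa> b(1) by (simp add: mult_le_cancel_left_pos)
    moreover have "P \<subseteq> {..<\<rho>}" by (auto simp: P_def)
    hence "card ({..<\<rho>} - P) = \<rho> - card P" "card P \<le> \<rho>"
      using card_mono[of "{..<\<rho>}" P] card_Diff_subset[of P "{..<\<rho>}"] finite_subset[of P "{..<\<rho>}"] by auto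
    ultimately show ?thesis by (simp add: of_nat_diff)
  qed
  define Small where "Small = (\<lambda>p. (\<Sum>j<\<rho>. \<bar>chaos N (defect S s) (block b j) (fst p) (snd p)\<bar>) \<le> 6 * \<epsilon> * 1470\<^sup>2 * N)"
  have large: "6 * \<epsilon> * 1470\<^sup>2 * N < sum \<gamma> P / 6"
  proof -
    have "\<epsilon> * sqrt b \<le> 1"
    proof (rule power2_le_imp_le)
      show "(\<epsilon> * sqrt b)\<^sup>2 \<le> 1\<^sup>2" using b by (simp add: power_mult_distrib mult.commute)
    qed simp
    hence "(\<epsilon> * sqrt b) * sqrt b \<le> 1 * sqrt b" by (intro mult_right_mono) auto
    hence eb: "\<epsilon> * b \<le> sqrt b" by (simp add: mult.assoc)
    have sb: "0 < sqrt b" using b by simp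
    have "6 * \<epsilon> * 1470\<^sup>2 * N = 6 * 1470\<^sup>2 * \<rho> * (\<epsilon> * b)" by (simp add: N_def)
    also have "\<dots> \<le> 6 * 1470\<^sup>2 * \<rho> * sqrt b" using eb by (intro mult_left_mono) auto
    also have "\<dots> < 73 / 12 * 1470\<^sup>2 * \<rho> * sqrt b" using \<rho> sb by simp
    also have "\<dots> = (\<rho> / 2) * (73 * 1470\<^sup>2 * sqrt b) / 6" by simp
    also have "\<dots> \<le> card P * (73 * 1470\<^sup>2 * sqrt b) / 6"
      using half sb by (intro divide_right_mono mult_right_mono) auto
    also have "\<dots> = (\<Sum>j\<in>P. 73 * 1470\<^sup>2 * sqrt b) / 6" by simp
    also have "\<dots> \<le> sum \<gamma> P / 6"
    proof (intro divide_right_mono sum_mono)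
      fix j assume "j \<in> P"
      have "73 * 1470\<^sup>2 * sqrt b = sqrt (defect_constant * b)" by (simp add: defect_constant_def real_sqrt_mult)
      also have "\<dots> \<le> \<gamma> j" using \<open>j \<in> P\<close> by (simp add: \<gamma>_def P_def)
      finally show "73 * 1470\<^sup>2 * sqrt b \<le> \<gamma> j" .
    qed simp
    finally show ?thesis .
  qed
  have fin2: "finite (signs N \<times> signs N)" "signs N \<times> signs N \<noteq> {}"
    using finite_signs signs_nonempty by auto
  have small_prob: "avg (signs N \<times> signs N) (\<lambda>p. of_bool (Small p)) \<le> 35 / 36"
  proof -
    have "1 / 36 \<le> avg (signs N \<times> signs N)
       (\<lambda>p. of_bool (sum \<gamma> P / 6 \<le> (\<Sum>j\<in>P. \<bar>chaos N (defect S s) (block b j) (fst p) (snd p)\<bar>)))"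
      unfolding \<gamma>_def by (rule chaos_blocks_anticoncentration) (auto simp: P_def N_def dest!: block_subset)
    also have "\<dots> \<le> avg (signs N \<times> signs N) (\<lambda>p. 1 - of_bool (Small p))"
    proof (rule avg_mono)
      fix p
      have "(\<Sum>j\<in>P. \<bar>chaos N (defect S s) (block b j) (fst p) (snd p)\<bar>)
         \<le> (\<Sum>j<\<rho>. \<bar>chaos N (defect S s) (block b j) (fst p) (snd p)\<bar>)"
        by (intro sum_mono2) (auto simp: P_def)
      thus "of_bool (sum \<gamma> P / 6 \<le> (\<Sum>j\<in>P. \<bar>chaos N (defect S s) (block b j) (fst p) (snd p)\<bar>))
         \<le> 1 - (of_bool (Small p) :: real)"
        using large by (auto simp: Small_def)
    qed
    also have "\<dots> = 1 - avg (signs N \<times> signs N) (\<lambda>p. of_bool (Small p))"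
      by (simp add: avg_diff avg_const[OF fin2])
    finally show ?thesis by simp
  qed
  define dens where "dens = (\<lambda>W z. avg grid (\<lambda>c. of_bool (G W z c)))"
  have dense: "\<forall>i\<in>{..<70}. Small (W i)"
    if W: "W \<in> sign_pairs N" and z: "z \<in> signs N" and d: "3 / 5 \<le> dens W z" for W z
  proof
    fix i :: nat assume i: "i \<in> {..<70}"
    have T: "finite ({0, 1} \<times> {..<10::nat})" "{0, 1} \<times> {..<10::nat} \<noteq> ({} :: (nat \<times> nat) set)"
      by (auto simp: lessThan_empty_iff)
    obtain g where g: "\<And>p. p \<in> {0, 1} \<times> {..<10} \<Longrightarrow> g(i := p) \<in> grid"
      and cg: "3 / 5 * card ({0, 1::nat} \<times> {..<10::nat}) \<le> card {p \<in> {0, 1} \<times> {..<10}. G W z (g(i := p))}"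
      using PiE_slice[OF _ i T d[unfolded dens_def grid_def]] unfolding grid_def by blast
    have "12 \<le> card {p \<in> {0, 1} \<times> {..<10}. G W z (g(i := p))}"
      using cg by (simp add: card_cartesian_product)
    from dense_in_grid_imp_rectangle[OF _ this]
    obtain \<tau> \<tau>' where \<tau>: "\<tau> < \<tau>'" and sub: "{0, 1} \<times> {\<tau>, \<tau>'} \<subseteq> {p \<in> {0, 1} \<times> {..<10}. G W z (g(i := p))}"
      by blast
    show "Small (W i)"
      unfolding Small_def N_def
    proof (rule rectangle_bound[OF \<epsilon> b(1) \<rho> W[unfolded N_def] z[unfolded N_def] _ \<tau>])
      fix p :: "nat \<times> nat" assume "p \<in> {0, 1} \<times> {\<tau>, \<tau>'}"
      hence p: "p \<in> {0, 1} \<times> {..<10}" "G W z (g(i := p))" using sub by blast+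
      show "g(i := p) \<in> grid \<and>
        (\<forall>w \<in> flipped_test b W z (g(i := p)) ` flips \<rho>. near_isometric \<epsilon> s S (\<rho> * b) w)"
        using g[OF p(1)] p(2) by (auto simp: G_def tests_def N_def)
    qed (use i in auto)
  qed
  have "2 / 3 \<le> avg (sign_pairs N) (\<lambda>W. avg (signs N) (dens W))"
    using good' by (simp add: avg_Times dens_def)
  also have "\<dots> \<le> avg (sign_pairs N) (\<lambda>W. avg (signs N) (\<lambda>z. 3 / 5 + 2 / 5 * of_bool (\<forall>i\<in>{..<70}. Small (W i))))"
  proof (intro avg_mono)
    fix W z assume W: "W \<in> sign_pairs N" and z: "z \<in> signs N"
    \<comment> \<open>a density is below \<open>3/5\<close>, or else at most \<open>1 = 3/5 + 2/5\<close> and then all pairs are small\<close>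
    have "dens W z \<le> avg grid (\<lambda>_. 1)" unfolding dens_def by (intro avg_mono) auto
    hence "dens W z \<le> 1" by (simp add: avg_const finite_grid grid_nonempty)
    thus "dens W z \<le> 3 / 5 + 2 / 5 * of_bool (\<forall>i\<in>{..<70}. Small (W i))"
      using dense[OF W z] by (cases "3 / 5 \<le> dens W z") auto
  qed
  also have "\<dots> = 3 / 5 + 2 / 5 * avg (sign_pairs N) (\<lambda>W. of_bool (\<forall>i\<in>{..<70}. Small (W i)))"
    by (simp only: avg_add avg_cmult avg_const finite_signs signs_nonempty finite_sign_pairs
        sign_pairs_nonempty not_False_eq_True)
  also have "avg (sign_pairs N) (\<lambda>W. of_bool (\<forall>i\<in>{..<70}. Small (W i)))
     = avg (signs N \<times> signs N) (\<lambda>p. of_bool (Small p)) ^ card {..<70::nat}"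
    unfolding sign_pairs_def by (rule avg_PiE_all[OF _ fin2]) simp
  also have "avg (signs N \<times> signs N) (\<lambda>p. of_bool (Small p)) ^ card {..<70::nat} \<le> (35 / 36) ^ card {..<70::nat}"
    by (intro power_mono small_prob avg_nonneg) auto
  also have "(35 / 36 :: real) ^ card {..<70::nat} < 1 / 6" by (simp add: power_divide)
  finally show False by simp
qed

section \<open>Orthonormal families and symmetric matrices\<close>

text \<open>
  Gram-Schmidt, except that \<open>x\<close> may already lie in the span. In that case one needs some unit
  vector orthogonal to the family: the squared norms of the projections of the \<open>m\<close> standard unit
  vectors add up to \<open>r < m\<close>, so one of them has a nonzero residual.
\<close>

lemma extend_orthonormal:
  fixes q :: "nat \<Rightarrow> nat \<Rightarrow> real" and x :: "nat \<Rightarrow> real"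
  assumes rm: "r < m"
    and orth: "\<And>l l'. l < r \<Longrightarrow> l' < r \<Longrightarrow> (\<Sum>k<m. q l k * q l' k) = (if l = l' then 1 else 0)"
  obtains p a \<beta> where "(\<Sum>k<m. p k * p k) = 1" "\<And>l. l < r \<Longrightarrow> (\<Sum>k<m. q l k * p k) = 0"
    "\<And>k. k < m \<Longrightarrow> x k = (\<Sum>l<r. a l * q l k) + \<beta> * p k"
proof -
  define pr where "pr = (\<lambda>x l. \<Sum>k<m. x k * q l k)"
  define res where "res = (\<lambda>x k. x k - (\<Sum>l<r. pr x l * q l k))"
  have res_orth: "(\<Sum>k<m. q l k * res x k) = 0" if l: "l < r" for x l
  proof -
    have "(\<Sum>k<m. q l k * res x k) = (\<Sum>k<m. x k * q l k) - (\<Sum>k<m. \<Sum>l'<r. pr x l' * (q l k * q l' k))"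
      unfolding res_def by (simp add: algebra_simps sum_subtractf sum_distrib_left)
    also have "(\<Sum>k<m. \<Sum>l'<r. pr x l' * (q l k * q l' k)) = (\<Sum>l'<r. pr x l' * (\<Sum>k<m. q l k * q l' k))"
      by (subst sum.swap) (simp add: sum_distrib_left)
    also have "\<dots> = (\<Sum>l'<r. if l' = l then pr x l' else 0)"
      using orth[OF l] by (intro sum.cong) auto
    also have "\<dots> = pr x l" using l by simp
    finally show ?thesis by (simp add: pr_def)
  qed
  obtain y where y: "(\<Sum>k<m. res y k * res y k) > 0" "y = x \<or> (\<forall>k<m. res x k = 0)"
  proof (cases "\<exists>k<m. res x k \<noteq> 0")
    case True
    then obtain k where "k < m" "res x k \<noteq> 0" by blast
    hence "(\<Sum>k<m. res x k * res x k) > 0"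
      by (intro sum_pos2[of _ k]) (auto simp: zero_less_mult_iff linorder_neq_iff)
    thus ?thesis using that[of x] by blast
  next
    case False
    have "(\<Sum>k<m. \<Sum>l<r. (q l k)\<^sup>2) = (\<Sum>l<r. \<Sum>k<m. q l k * q l k)"
      by (subst sum.swap) (simp add: power2_eq_square)
    also have "\<dots> = r" using orth by simp
    also have "\<dots> < (\<Sum>k<m. 1)" using rm by simp
    finally obtain k where k: "k < m" "(\<Sum>l<r. (q l k)\<^sup>2) < 1"
      by (metis (no_types, lifting) lessThan_iff linorder_not_less sum_mono)
    define e where "e = (\<lambda>i. if i = k then 1 else (0::real))"
    have "pr e l = q l k" for l
    proof -
      have "pr e l = (\<Sum>i<m. if i = k then q l i else 0)"
        unfolding pr_def e_def by (intro sum.cong) auto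
      thus ?thesis using k by simp
    qed
    hence "res e k = 1 - (\<Sum>l<r. (q l k)\<^sup>2)" by (simp add: res_def e_def power2_eq_square)
    hence "res e k > 0" using k by simp
    hence "(\<Sum>k<m. res e k * res e k) > 0" using k(1) by (intro sum_pos2[of _ k]) auto
    thus ?thesis using that[of e] False by blast
  qed
  define n where "n = sqrt (\<Sum>k<m. res y k * res y k)"
  have n: "n > 0" "n * n = (\<Sum>k<m. res y k * res y k)" using y(1) by (auto simp: n_def)
  define p where "p = (\<lambda>k. res y k / n)"
  show ?thesis
  proof (rule that[of p "pr x" "if y = x then n else 0"])
    have "(\<Sum>k<m. p k * p k) = (\<Sum>k<m. res y k * res y k) / (n * n)"
      by (simp add: p_def sum_divide_distrib)
    also have "\<dots> = (n * n) / (n * n)" by (simp only: n(2))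
    finally show "(\<Sum>k<m. p k * p k) = 1" using n(1) by simp
    show "(\<Sum>k<m. q l k * p k) = 0" if "l < r" for l
      using res_orth[OF that, of y] by (simp add: p_def sum_divide_distrib[symmetric])
    show "x k = (\<Sum>l<r. pr x l * q l k) + (if y = x then n else 0) * p k" if "k < m" for k
    proof -
      have "(if y = x then n else 0) * p k = res x k" using y(2) that n by (auto simp: p_def)
      thus ?thesis by (simp add: res_def)
    qed
  qed
qed

lemma orthonormal_spanning:
  fixes u :: "nat \<Rightarrow> nat \<Rightarrow> real"
  assumes "r \<le> m"
  shows "\<exists>q a. (\<forall>l<r. \<forall>l'<r. (\<Sum>k<m. q l k * q l' k) = (if l = l' then 1 else 0)) \<and>
     (\<forall>l<r. \<forall>k<m. u l k = (\<Sum>l'<r. a l l' * q l' k))"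
  using assms
proof (induction r)
  case 0
  show ?case by simp
next
  case (Suc r)
  then obtain q :: "nat \<Rightarrow> nat \<Rightarrow> real" and a :: "nat \<Rightarrow> nat \<Rightarrow> real"
    where q: "\<And>l l'. l < r \<Longrightarrow> l' < r \<Longrightarrow> (\<Sum>k<m. q l k * q l' k) = (if l = l' then 1 else 0)"
      and a: "\<And>l k. l < r \<Longrightarrow> k < m \<Longrightarrow> u l k = (\<Sum>l'<r. a l l' * q l' k)"
    using Suc_leD by blast
  obtain p c \<beta> where p: "(\<Sum>k<m. p k * p k) = 1" "\<And>l. l < r \<Longrightarrow> (\<Sum>k<m. q l k * p k) = 0"
    "\<And>k. k < m \<Longrightarrow> u r k = (\<Sum>l<r. c l * q l k) + \<beta> * p k"
  proof (rule extend_orthonormal[OF Suc_le_lessD[OF Suc.prems], of q "u r", OF q])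
    fix p c \<beta>
    assume "(\<Sum>k<m. p k * p k) = 1" "\<And>l. l < r \<Longrightarrow> (\<Sum>k<m. q l k * p k) = 0"
      "\<And>k. k < m \<Longrightarrow> u r k = (\<Sum>l<r. c l * q l k) + \<beta> * p k"
    thus thesis by (rule that[of p c \<beta>])
  qed
  define q' where "q' = q(r := p)"
  define a' where "a' = (\<lambda>l l'. if l = r then (if l' = r then \<beta> else c l') else if l' = r then 0 else a l l')"
  have q'r: "q' r = p" "\<And>l. l < r \<Longrightarrow> q' l = q l" by (auto simp: q'_def)
  show ?case
  proof (rule exI[of _ q'], rule exI[of _ a'], intro conjI allI impI)
    fix l l' assume "l < Suc r" "l' < Suc r"
    then consider "l < r" "l' < r" | "l = r" "l' < r" | "l < r" "l' = r" | "l = r" "l' = r" by linarith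
    thus "(\<Sum>k<m. q' l k * q' l' k) = (if l = l' then 1 else 0)"
    proof cases
      case 2
      have "(\<Sum>k<m. p k * q l' k) = (\<Sum>k<m. q l' k * p k)" by (simp add: mult.commute)
      thus ?thesis using 2 p q'r by auto
    qed (use p q q'r in auto)
  next
    fix l k assume l: "l < Suc r" and k: "k < m"
    have "(\<Sum>l'<r. a' l l' * q' l' k) = (\<Sum>l'<r. (if l = r then c l' else a l l') * q l' k)"
      by (intro sum.cong) (auto simp: a'_def q'_def)
    moreover have "a' l r * q' r k = (if l = r then \<beta> * p k else 0)" by (simp add: a'_def q'_def)
    moreover have "l = r \<or> l < r" using l by linarith
    ultimately show "u l k = (\<Sum>l'<Suc r. a' l l' * q' l' k)"
      using a[OF _ k, of l] p(3)[OF k] by auto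
  qed
qed

lemma symmetric_mat_adjoint:
  fixes M :: "real mat"
  assumes "M \<in> carrier_mat r r" "transpose_mat M = M" "u \<in> carrier_vec r" "v \<in> carrier_vec r"
  shows "(M *\<^sub>v u) \<bullet> v = u \<bullet> (M *\<^sub>v v)"
  using transpose_vec_mult_scalar[of M r r v u] assms
  by (metis comm_scalar_prod mult_mat_vec_carrier)

lemma scalar_prod_Cauchy_Schwarz:
  fixes u v :: "real vec"
  assumes "u \<in> carrier_vec r" "v \<in> carrier_vec r"
  shows "(u \<bullet> v)\<^sup>2 \<le> (u \<bullet> u) * (v \<bullet> v)"
  using Cauchy_Schwarz_ineq_sum[of "\<lambda>i. u $ i" "\<lambda>i. v $ i" "{0..<r}"] assms
  by (simp add: scalar_prod_def power2_eq_square)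

text \<open>
  With \<open>b\<^sub>k = \<parallel>M\<^sup>k u\<parallel>\<^sup>2\<close>, symmetry and Cauchy-Schwarz give \<open>b\<^sub>k\<^sup>2 \<le> b\<^sub>0 b\<^bsub>2k\<^esub>\<close>. So if
  \<open>b\<^sub>1 > b\<^sub>0\<close>, the \<open>b\<^sub>k\<close> grow without bound along the powers of two.
\<close>

lemma symmetric_power_bounded_contraction:
  fixes M :: "real mat"
  assumes M: "M \<in> carrier_mat r r" and sym: "transpose_mat M = M"
    and bound: "\<And>k i j. i < r \<Longrightarrow> j < r \<Longrightarrow> \<bar>(M ^\<^sub>m k) $$ (i, j)\<bar> \<le> C"
    and u: "u \<in> carrier_vec r"
  shows "\<bar>u \<bullet> (M *\<^sub>v u)\<bar> \<le> u \<bullet> u"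
proof -
  define f where "f = (\<lambda>k. ((\<lambda>v. M *\<^sub>v v) ^^ k) u)"
  have fc: "f k \<in> carrier_vec r" for k by (induction k) (use u M in \<open>auto simp: f_def\<close>)
  have f0: "f 0 = u" and fS: "f (Suc k) = M *\<^sub>v f k" for k by (auto simp: f_def)
  have shift: "f (i + k) \<bullet> f j = f k \<bullet> f (i + j)" for i j k
  proof (induction i arbitrary: j)
    case (Suc i)
    have "f (Suc i + k) \<bullet> f j = f (i + k) \<bullet> f (Suc j)"
      using symmetric_mat_adjoint[OF M sym fc fc, of "i + k" j] by (simp add: fS)
    thus ?case using Suc[of "Suc j"] by simp
  qed simp
  define b where "b = (\<lambda>k. f k \<bullet> f k)"
  have b0: "0 \<le> b k" for k unfolding b_def scalar_prod_def by (intro sum_nonneg) auto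
  have bconv: "(b k)\<^sup>2 \<le> b 0 * b (2 * k)" for k
  proof -
    have "b k = f 0 \<bullet> f (2 * k)" unfolding b_def using shift[of k 0 k] by (simp add: mult_2)
    thus ?thesis using scalar_prod_Cauchy_Schwarz[OF fc fc, of 0 "2 * k"] by (simp add: b_def)
  qed
  have fpow: "f k = M ^\<^sub>m k *\<^sub>v u" for k
  proof (induction k)
    case 0
    show ?case using u M by (simp add: f_def)
  next
    case (Suc k)
    have comm: "M ^\<^sub>m Suc k = M * M ^\<^sub>m k"
      by (induction k) (use M in \<open>auto simp: assoc_mult_mat[of _ r r _ r _ r]\<close>)
    show ?case unfolding fS Suc comm using M u by (subst assoc_mult_mat_vec[of _ r r _ r]) auto
  qed
  define C' where "C' = r * (\<bar>C\<bar> * (\<Sum>j<r. \<bar>u $ j\<bar>))\<^sup>2"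
  have bC: "b k \<le> C'" for k
  proof -
    have "\<bar>f k $ i\<bar> \<le> \<bar>C\<bar> * (\<Sum>j<r. \<bar>u $ j\<bar>)" if i: "i < r" for i
    proof -
      have "f k $ i = (\<Sum>j<r. (M ^\<^sub>m k) $$ (i, j) * u $ j)"
        unfolding fpow using i M u by (simp add: scalar_prod_def lessThan_atLeast0)
      also have "\<bar>\<dots>\<bar> \<le> (\<Sum>j<r. \<bar>C\<bar> * \<bar>u $ j\<bar>)"
      proof (intro order_trans[OF sum_abs] sum_mono)
        fix j assume "j \<in> {..<r}"
        hence "\<bar>(M ^\<^sub>m k) $$ (i, j)\<bar> \<le> \<bar>C\<bar>" using bound[OF i, of j k] by simp
        thus "\<bar>(M ^\<^sub>m k) $$ (i, j) * u $ j\<bar> \<le> \<bar>C\<bar> * \<bar>u $ j\<bar>" by (simp add: abs_mult mult_right_mono)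
      qed
      finally show ?thesis by (simp add: sum_distrib_left)
    qed
    hence "(\<Sum>i<r. (f k $ i)\<^sup>2) \<le> (\<Sum>i<r. (\<bar>C\<bar> * (\<Sum>j<r. \<bar>u $ j\<bar>))\<^sup>2)"
      by (intro sum_mono) (simp add: abs_le_square_iff[symmetric] sum_nonneg abs_mult)
    thus ?thesis using fc[of k] by (simp add: b_def C'_def scalar_prod_def lessThan_atLeast0 power2_eq_square)
  qed
  have b1: "b 1 \<le> b 0"
  proof (rule ccontr)
    assume "\<not> b 1 \<le> b 0"
    hence lt: "b 0 < b 1" by simp
    have pos: "b 0 > 0"
      using bconv[of 1] lt b0[of 0] by (cases "b 0 = 0") auto
    define t where "t = b 1 / b 0"
    have t: "t > 1" using lt pos by (simp add: t_def)
    have grow: "t ^ (2 ^ n) * b 0 \<le> b (2 ^ n)" for n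
    proof (induction n)
      case 0
      show ?case using pos by (simp add: t_def)
    next
      case (Suc n)
      have "(t ^ (2 ^ n) * b 0)\<^sup>2 \<le> (b (2 ^ n))\<^sup>2"
        using Suc t pos by (intro power_mono) auto
      also have "\<dots> \<le> b 0 * b (2 ^ Suc n)" using bconv[of "2 ^ n"] by simp
      finally have "b 0 * (t ^ (2 ^ Suc n) * b 0) \<le> b 0 * b (2 ^ Suc n)"
        by (simp add: power_mult_distrib power_mult[symmetric] power2_eq_square[of "b 0"] mult_ac)
      thus ?case using pos by simp
    qed
    obtain n where n: "C' / b 0 < t ^ n" using real_arch_pow[OF t] by blast
    have "t ^ n \<le> t ^ (2 ^ n)" using t by (intro power_increasing) (auto intro: less_imp_le)
    hence "C' / b 0 < t ^ (2 ^ n)" using n by simp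
    hence "C' < t ^ (2 ^ n) * b 0" using pos by (simp add: field_simps)
    thus False using grow[of n] bC[of "2 ^ n"] by simp
  qed
  have "(u \<bullet> (M *\<^sub>v u))\<^sup>2 \<le> b 0 * b 1"
    using scalar_prod_Cauchy_Schwarz[OF fc fc, of 0 1] by (simp add: b_def fS f0)
  also have "\<dots> \<le> (b 0)\<^sup>2" using b1 b0 by (simp add: power2_eq_square mult_left_mono)
  finally show ?thesis using b0[of 0] by (simp add: abs_le_square_iff[symmetric] b_def f0)
qed

text \<open>
  After the shift by \<open>c\<close> and a scaling by slightly more than \<open>\<rho>\<close> the spectral radius is less
  than \<open>1\<close>. Then the powers are bounded, and for a symmetric matrix this bounds the quadratic form.
\<close>

lemma symmetric_quadratic_form_bound:
  fixes M :: "real mat" and \<rho> c :: real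
  assumes M: "M \<in> carrier_mat r r" and sym: "transpose_mat M = M"
    and cp: "char_poly M = (\<Prod>e\<leftarrow>es. [:- e, 1:])"
    and es: "\<And>e. e \<in> set es \<Longrightarrow> \<bar>e - c\<bar> \<le> \<rho>" and \<rho>: "0 \<le> \<rho>"
    and u: "u \<in> carrier_vec r"
  shows "\<bar>u \<bullet> (M *\<^sub>v u) - c * (u \<bullet> u)\<bar> \<le> \<rho> * (u \<bullet> u)"
proof -
  have uu: "0 \<le> u \<bullet> u" unfolding scalar_prod_def by (intro sum_nonneg) auto
  have main: "\<bar>u \<bullet> (M *\<^sub>v u) - c * (u \<bullet> u)\<bar> \<le> \<sigma> * (u \<bullet> u)" if \<sigma>: "\<rho> < \<sigma>" for \<sigma>
  proof (cases "r = 0")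
    case True
    thus ?thesis using u by (simp add: scalar_prod_def)
  next
    case False
    hence r: "r > 0" by simp
    have \<sigma>0: "\<sigma> > 0" using \<sigma> \<rho> by simp
    define N where "N = mat r r (\<lambda>(i, j). (M $$ (i, j) - (if i = j then c else 0)) / \<sigma>)"
    have N: "N \<in> carrier_mat r r" by (simp add: N_def)
    have symN: "transpose_mat N = N"
    proof (rule eq_matI)
      fix i j assume ij: "i < dim_row N" "j < dim_col N"
      have "M $$ (j, i) = transpose_mat M $$ (i, j)" using ij M by (auto simp: N_def)
      hence "M $$ (j, i) = M $$ (i, j)" by (simp add: sym)
      thus "transpose_mat N $$ (i, j) = N $$ (i, j)" using ij by (auto simp: N_def)
    qed (auto simp: N_def)
    define NC where "NC = map_mat complex_of_real N"
    have NC: "NC \<in> carrier_mat r r" using N by (simp add: NC_def)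
    define MC where "MC = map_mat complex_of_real M"
    have MC: "MC \<in> carrier_mat r r" using M by (simp add: MC_def)
    have "norm ev < 1" if ev: "ev \<in> spectrum NC" for ev
    proof -
      obtain v where v: "v \<in> carrier_vec r" "v \<noteq> 0\<^sub>v r" "NC *\<^sub>v v = ev \<cdot>\<^sub>v v"
        using ev NC by (auto simp: spectrum_def eigenvalue_def eigenvector_def)
      have "MC *\<^sub>v v = (\<sigma> * ev + c) \<cdot>\<^sub>v v"
      proof (rule eq_vecI)
        fix i assume "i < dim_vec ((\<sigma> * ev + c) \<cdot>\<^sub>v v)"
        hence i: "i < r" using v by simp
        have "(NC *\<^sub>v v) $ i = (\<Sum>j<r. (complex_of_real (M $$ (i, j)) * v $ j - (if j = i then c * v $ j else 0)) / \<sigma>)"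
          using i v(1) M unfolding NC_def N_def
          by (auto simp: scalar_prod_def lessThan_atLeast0 intro!: sum.cong) (simp add: algebra_simps)
        also have "\<dots> = ((\<Sum>j<r. complex_of_real (M $$ (i, j)) * v $ j) - (\<Sum>j<r. if j = i then c * v $ j else 0)) / \<sigma>"
          by (simp add: sum_subtractf sum_divide_distrib[symmetric])
        also have "(\<Sum>j<r. if j = i then c * v $ j else 0) = c * v $ i" using i by simp
        also have "(\<Sum>j<r. complex_of_real (M $$ (i, j)) * v $ j) = (MC *\<^sub>v v) $ i"
          using i v(1) M unfolding MC_def by (auto simp: scalar_prod_def lessThan_atLeast0 intro!: sum.cong)
        finally have "ev * v $ i = ((MC *\<^sub>v v) $ i - c * v $ i) / \<sigma>" using v i by simp
        thus "(MC *\<^sub>v v) $ i = ((\<sigma> * ev + c) \<cdot>\<^sub>v v) $ i" using \<sigma>0 i v(1) by (simp add: field_simps)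
      qed (use MC v in auto)
      hence "eigenvalue MC (\<sigma> * ev + c)" using v MC by (auto simp: eigenvalue_def eigenvector_def)
      hence "poly (char_poly MC) (\<sigma> * ev + c) = 0" using eigenvalue_root_char_poly[OF MC] by simp
      moreover have "char_poly MC = (\<Prod>e\<leftarrow>es. [:- complex_of_real e, 1:])"
      proof -
        interpret h: map_poly_comm_ring_hom "of_real :: real \<Rightarrow> complex" ..
        have "map_poly of_real (\<Prod>e\<leftarrow>es. [:- e, 1:]) = (\<Prod>e\<leftarrow>es. [:- complex_of_real e, 1:])"
        proof (induction es)
          case (Cons e es)
          have "map_poly complex_of_real [:- e, 1:] = [:- complex_of_real e, 1:]" by simp
          thus ?case by (simp only: list.map prod_list.Cons h.hom_mult Cons.IH)
        qed simp
        thus ?thesis unfolding MC_def of_real_hom.char_poly_hom[OF M] cp .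
      qed
      ultimately obtain e where e: "e \<in> set es" "\<sigma> * ev + c = complex_of_real e"
        by (auto simp: poly_prod_list prod_list_zero_iff)
      hence "ev = complex_of_real ((e - c) / \<sigma>)" using \<sigma>0 by (simp add: field_simps)
      hence "norm ev = \<bar>(e - c) / \<sigma>\<bar>" by (simp only: norm_of_real)
      thus ?thesis using es[OF e(1)] \<sigma> \<sigma>0 by (simp add: abs_divide)
    qed
    hence "spectral_radius NC < 1" using spectral_radius_mem_max(1)[OF NC r] by auto
    then obtain C where C: "\<And>k. norm_bound (NC ^\<^sub>m k) C"
      using spectral_radius_jnf_norm_bound_less_1_upper_triangular[OF NC] by blast
    have bd: "\<bar>(N ^\<^sub>m k) $$ (i, j)\<bar> \<le> C" if "i < r" "j < r" for k i j
    proof -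
      have "NC ^\<^sub>m k = map_mat complex_of_real (N ^\<^sub>m k)"
        unfolding NC_def by (rule of_real_hom.mat_hom_pow[OF N, symmetric])
      moreover have "dim_row (N ^\<^sub>m k) = r" "dim_col (N ^\<^sub>m k) = r" using pow_carrier_mat[OF N, of k] by auto
      ultimately show ?thesis using C[of k] that by (simp add: norm_bound_def del: pow_mat_dim)
    qed
    have "\<bar>u \<bullet> (N *\<^sub>v u)\<bar> \<le> u \<bullet> u"
      by (rule symmetric_power_bounded_contraction[OF N symN bd u])
    moreover have "u \<bullet> (N *\<^sub>v u) = (u \<bullet> (M *\<^sub>v u) - c * (u \<bullet> u)) / \<sigma>"
    proof -
      have "(N *\<^sub>v u) $ i = ((M *\<^sub>v u) $ i - c * u $ i) / \<sigma>" if i: "i < r" for i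
      proof -
        have "(N *\<^sub>v u) $ i = (\<Sum>j<r. (M $$ (i, j) * u $ j - (if j = i then c * u $ j else 0)) / \<sigma>)"
          using i u M unfolding N_def
          by (auto simp: scalar_prod_def lessThan_atLeast0 intro!: sum.cong) (simp add: algebra_simps)
        also have "\<dots> = ((\<Sum>j<r. M $$ (i, j) * u $ j) - (\<Sum>j<r. if j = i then c * u $ j else 0)) / \<sigma>"
          by (simp add: sum_subtractf sum_divide_distrib[symmetric])
        also have "(\<Sum>j<r. if j = i then c * u $ j else 0) = c * u $ i" using i by simp
        also have "(\<Sum>j<r. M $$ (i, j) * u $ j) = (M *\<^sub>v u) $ i"
          using i u M by (auto simp: scalar_prod_def lessThan_atLeast0 intro!: sum.cong)
        finally show ?thesis .
      qed
      hence "u \<bullet> (N *\<^sub>v u) = (\<Sum>i<r. (u $ i * (M *\<^sub>v u) $ i - c * (u $ i * u $ i)) / \<sigma>)"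
        unfolding scalar_prod_def[of u "N *\<^sub>v u"] using N
        by (auto simp: lessThan_atLeast0 algebra_simps intro!: sum.cong)
      also have "\<dots> = (u \<bullet> (M *\<^sub>v u) - c * (u \<bullet> u)) / \<sigma>"
        using M u by (simp add: scalar_prod_def lessThan_atLeast0 sum_subtractf sum_divide_distrib[symmetric] sum_distrib_left)
      finally show ?thesis .
    qed
    ultimately show ?thesis using \<sigma>0 by (simp add: abs_divide field_simps)
  qed
  show ?thesis
  proof (rule field_le_epsilon)
    fix e :: real assume e: "0 < e"
    define \<sigma> where "\<sigma> = \<rho> + e / (u \<bullet> u + 1)"
    have "\<rho> < \<sigma>" using e uu by (simp add: \<sigma>_def add_nonneg_pos)
    from main[OF this] have "\<bar>u \<bullet> (M *\<^sub>v u) - c * (u \<bullet> u)\<bar> \<le> \<sigma> * (u \<bullet> u)" .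
    also have "\<dots> = \<rho> * (u \<bullet> u) + e * ((u \<bullet> u) / (u \<bullet> u + 1))" by (simp add: \<sigma>_def algebra_simps)
    also have "\<dots> \<le> \<rho> * (u \<bullet> u) + e * 1" using e uu by (intro add_left_mono mult_left_mono) (auto simp: field_simps)
    finally show "\<bar>u \<bullet> (M *\<^sub>v u) - c * (u \<bullet> u)\<bar> \<le> \<rho> * (u \<bullet> u) + e" by simp
  qed
qed

section \<open>Singular values of sketched orthonormal matrices\<close>

lemma char_poly_zero_padded:
  fixes C G :: "real mat"
  assumes C: "C \<in> carrier_mat p n" and rn: "r \<le> n"
    and zero: "\<And>k j. k < p \<Longrightarrow> r \<le> j \<Longrightarrow> j < n \<Longrightarrow> C $$ (k, j) = 0"
  defines "G \<equiv> mat r r (\<lambda>(i, j). \<Sum>k<p. C $$ (k, i) * C $$ (k, j))"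
  shows "char_poly (transpose_mat C * C) = char_poly G * [:0, 1:] ^ (n - r)"
proof -
  have CC: "transpose_mat C * C \<in> carrier_mat n n" using C by auto
  have G: "G \<in> carrier_mat r r" by (simp add: G_def)
  have ent: "(transpose_mat C * C) $$ (i, j) = (\<Sum>k<p. C $$ (k, i) * C $$ (k, j))" if "i < n" "j < n" for i j
    using that C by (auto simp: scalar_prod_def lessThan_atLeast0)
  let ?Z = "[:0, 1:] \<cdot>\<^sub>m 1\<^sub>m (n - r) :: real poly mat"
  have "char_poly_matrix (transpose_mat C * C)
      = four_block_mat (char_poly_matrix G) (0\<^sub>m r (n - r)) (0\<^sub>m (n - r) r) ?Z" (is "?L = ?R")
  proof (rule eq_matI)
    fix i j assume "i < dim_row ?R" "j < dim_col ?R"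
    hence ij: "i < n" "j < n" using G rn by (auto simp: char_poly_matrix_def)
    have z: "(transpose_mat C * C) $$ (i, j) = 0" if "r \<le> i \<or> r \<le> j"
      unfolding ent[OF ij] using that zero ij by (intro sum.neutral) auto
    show "?L $$ (i, j) = ?R $$ (i, j)"
      using ij CC G rn z ent[OF ij] C
      by (auto simp: char_poly_matrix_def G_def)
  qed (use CC G rn in \<open>auto simp: char_poly_matrix_def\<close>)
  hence "char_poly (transpose_mat C * C) = det (char_poly_matrix G) * det ?Z"
    unfolding char_poly_def using G
    by (simp add: det_four_block_mat_lower_left_zero[of _ r _ "n - r"])
  also have "det ?Z = [:0, 1:] ^ (n - r)" by (simp add: det_smult)
  finally show ?thesis by (simp add: char_poly_def)
qed

lemma proots_char_poly_zero_padded: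
  fixes C :: "real mat"
  assumes C: "C \<in> carrier_mat p n" and rn: "r \<le> n"
    and zero: "\<And>k j. k < p \<Longrightarrow> r \<le> j \<Longrightarrow> j < n \<Longrightarrow> C $$ (k, j) = 0"
  shows "proots (char_poly (transpose_mat C * C))
    = proots (char_poly (mat r r (\<lambda>(i, j). \<Sum>k<p. C $$ (k, i) * C $$ (k, j)))) + replicate_mset (n - r) 0"
proof -
  define G where "G = mat r r (\<lambda>(i, j). \<Sum>k<p. C $$ (k, i) * C $$ (k, j))"
  have "char_poly G \<noteq> 0" using degree_monic_char_poly[of G r] by (auto simp: G_def)
  moreover have "proots ([:0, 1:] ^ k :: real poly) = replicate_mset k 0" for k
    by (induction k) (simp_all add: proots_mult del: mult_pCons_left mult_pCons_right)
  ultimately show ?thesis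
    using char_poly_zero_padded[OF C rn zero] by (simp add: G_def[symmetric] proots_mult del: mult_pCons_left mult_pCons_right)
qed

lemma mset_singular_values:
  "mset (singular_values C) = image_mset sqrt (proots (char_poly (transpose_mat C * C)))"
  by (simp add: singular_values_def)

lemma singular_value_orthonormal:
  fixes A :: "real mat"
  assumes A: "A \<in> carrier_mat m n" and rn: "r \<le> n"
    and zero: "\<And>k j. k < m \<Longrightarrow> r \<le> j \<Longrightarrow> j < n \<Longrightarrow> A $$ (k, j) = 0"
    and orth: "\<And>i j. i < r \<Longrightarrow> j < r \<Longrightarrow> (\<Sum>k<m. A $$ (k, i) * A $$ (k, j)) = (if i = j then 1 else 0)"
    and i: "1 \<le> i" "i \<le> r"
  shows "singular_value i A = 1"
proof -
  have "mat r r (\<lambda>(i, j). \<Sum>k<m. A $$ (k, i) * A $$ (k, j)) = 1\<^sub>m r"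
    by (rule eq_matI) (auto simp: orth)
  moreover have "proots (char_poly (1\<^sub>m r :: real mat)) = replicate_mset r 1"
  proof -
    have "diag_mat (1\<^sub>m r :: real mat) = replicate r 1" by (rule nth_equalityI) (auto simp: diag_mat_def)
    hence "char_poly (1\<^sub>m r :: real mat) = [:- 1, 1:] ^ r"
      by (subst char_poly_upper_triangular[of _ r]) (simp_all add: prod_list_replicate)
    moreover have "proots ([:- 1, 1:] ^ k :: real poly) = replicate_mset k 1" for k
      by (induction k) (simp_all add: proots_mult del: mult_pCons_left mult_pCons_right)
    ultimately show ?thesis by simp
  qed
  ultimately have "proots (char_poly (transpose_mat A * A)) = replicate_mset r 1 + replicate_mset (n - r) 0"
    using proots_char_poly_zero_padded[OF A rn zero] by simp
  hence "image_mset sqrt (proots (char_poly (transpose_mat A * A))) = mset (replicate (n - r) 0 @ replicate r 1)"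
    by simp
  moreover have "sort (replicate (n - r) 0 @ replicate r (1::real)) = replicate (n - r) 0 @ replicate r 1"
    by (rule sorted_sort_id) (auto simp: sorted_append)
  ultimately have "singular_values A = replicate r 1 @ replicate (n - r) 0"
    by (simp only: singular_values_def sorted_list_of_multiset_mset) simp
  thus ?thesis using i by (auto simp: singular_value_def nth_append)
qed

lemma monic_split_by_proots:
  fixes p :: "real poly"
  assumes "monic p" "size (proots p) = degree p" "mset es = proots p"
  shows "p = (\<Prod>e\<leftarrow>es. [:- e, 1:])"
  using assms
proof (induction es arbitrary: p)
  case Nil
  hence "degree p = 0" by simp
  then obtain c where "p = [:c:]" by (auto elim: degree_eq_zeroE)
  thus ?case using Nil by simp
next
  case (Cons e es)
  have p0: "p \<noteq> 0" using Cons.prems(1) by auto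
  have "e \<in># proots p" using Cons.prems(3) by (metis list.set_intros(1) set_mset_mset)
  hence "poly p e = 0" using p0 by simp
  then obtain p' where p': "p = [:- e, 1:] * p'" by (auto simp: poly_eq_0_iff_dvd dvd_def)
  have p'0: "p' \<noteq> 0" using p0 p' by auto
  have pr: "proots p = {#e#} + proots p'"
    unfolding p' using p'0 by (subst proots_mult) auto
  have deg: "degree p = Suc (degree p')" unfolding p' using p'0 by (subst degree_mult_eq) auto
  have "monic p'" using Cons.prems(1) unfolding p' lead_coeff_mult by simp
  moreover have "size (proots p') = degree p'" using Cons.prems(2) pr deg by simp
  moreover have "mset es = proots p'" using Cons.prems(3) pr by simp
  ultimately have "p' = (\<Prod>e\<leftarrow>es. [:- e, 1:])" by (rule Cons.IH)
  thus ?case by (simp add: p' del: mult_pCons_left)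
qed

text \<open>
  The padding zeros cannot occupy the \<open>r\<close> leading nonzero places, so these exhaust the at most
  \<open>r\<close> elements of \<open>M\<close>.
\<close>

lemma leading_nonzero_eigenvalues:
  fixes L :: "real list"
  assumes L: "mset L = M + replicate_mset k 0" and size: "size M \<le> r"
    and len: "r \<le> length L" and nz: "\<And>i. i < r \<Longrightarrow> L ! i \<noteq> 0"
  shows "M = mset (take r L)"
proof -
  have "filter_mset (\<lambda>x. x \<noteq> 0) (mset (take r L)) = mset (take r L)"
    using nz len by (intro filter_mset_eq_conv[THEN iffD2]) (auto simp: in_set_conv_nth)
  hence "mset (take r L) \<subseteq># filter_mset (\<lambda>x. x \<noteq> 0) (mset (take r L) + mset (drop r L))"
    by (simp only: filter_union_mset mset_subset_eq_add_left)
  also have "mset (take r L) + mset (drop r L) = M + replicate_mset k 0"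
    by (metis L append_take_drop_id mset_append)
  also have "filter_mset (\<lambda>x. x \<noteq> 0) (M + replicate_mset k 0) = filter_mset (\<lambda>x. x \<noteq> 0) M" by simp
  also have "\<dots> \<subseteq># M" by simp
  finally have sub: "mset (take r L) \<subseteq># M" .
  moreover have "size M \<le> size (mset (take r L))" using size len by simp
  ultimately show ?thesis by (metis mset_subset_size not_less subset_mset.le_less)
qed

text \<open>
  All leading singular values of \<open>A\<close> are \<open>1\<close>, so those of \<open>S A\<close> lie in \<open>[1 - \<epsilon>, 1 + \<epsilon>]\<close>.
  Being \<open>r\<close> nonzero values, they come from all the eigenvalues of the \<open>r \<times> r\<close> Gram matrix
  \<open>G\<close> of the first \<open>r\<close> columns of \<open>S A\<close>; in particular its characteristic polynomial splits over the
  reals. The eigenvalues lie in \<open>[(1 - \<epsilon>)\<^sup>2, (1 + \<epsilon>)\<^sup>2]\<close>, the interval with centre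
  \<open>1 + \<epsilon>\<^sup>2\<close> and radius \<open>2 \<epsilon>\<close>.
\<close>

lemma near_isometric_of_preserves:
  fixes A S :: "real mat"
  assumes S: "S \<in> carrier_mat s m" and A: "A \<in> carrier_mat m n" and rn: "r \<le> n"
    and zero: "\<And>k j. k < m \<Longrightarrow> r \<le> j \<Longrightarrow> j < n \<Longrightarrow> A $$ (k, j) = 0"
    and orth: "\<And>i j. i < r \<Longrightarrow> j < r \<Longrightarrow> (\<Sum>k<m. A $$ (k, i) * A $$ (k, j)) = (if i = j then 1 else 0)"
    and pres: "preserves_singular_values \<epsilon> r A S" and \<epsilon>: "0 < \<epsilon>" "\<epsilon> < 1 / 2"
    and w: "\<And>k. k < m \<Longrightarrow> w k = (\<Sum>l<r. a l * A $$ (k, l))"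
  shows "near_isometric \<epsilon> s (\<lambda>i k. S $$ (i, k)) m w"
proof -
  define C where "C = S * A"
  have C: "C \<in> carrier_mat s n" using S A by (simp add: C_def)
  have Cent: "C $$ (i, j) = (\<Sum>k<m. S $$ (i, k) * A $$ (k, j))" if "i < s" "j < n" for i j
    using that S A by (auto simp: C_def scalar_prod_def lessThan_atLeast0)
  have Czero: "C $$ (i, j) = 0" if "i < s" "r \<le> j" "j < n" for i j
    unfolding Cent[OF that(1,3)] using zero that by (intro sum.neutral) auto
  define G where "G = mat r r (\<lambda>(i, j). \<Sum>k<s. C $$ (k, i) * C $$ (k, j))"
  have G: "G \<in> carrier_mat r r" by (simp add: G_def)
  note mon = degree_monic_char_poly[OF G]
  define L where "L = singular_values C"
  have L: "mset L = image_mset sqrt (proots (char_poly G)) + replicate_mset (n - r) 0"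
    using proots_char_poly_zero_padded[OF C rn Czero] by (simp add: L_def mset_singular_values G_def)
  have sv: "1 - \<epsilon> \<le> singular_value i C" "singular_value i C \<le> 1 + \<epsilon>" if "1 \<le> i" "i \<le> r" for i
  proof -
    have "(1 - \<epsilon>) * singular_value i A \<le> singular_value i C" "singular_value i C \<le> (1 + \<epsilon>) * singular_value i A"
      using pres that unfolding preserves_singular_values_def C_def by (meson atLeastAtMost_iff)+
    thus "1 - \<epsilon> \<le> singular_value i C" "singular_value i C \<le> 1 + \<epsilon>"
      using singular_value_orthonormal[OF A rn zero orth that] by simp_all
  qed
  have len: "r \<le> length L"
  proof (cases "r = 0")
    case False
    hence "singular_value r C \<noteq> 0" using sv[of r] \<epsilon> by auto
    thus ?thesis by (auto simp: singular_value_def L_def split: if_splits)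
  qed simp
  have Li: "1 - \<epsilon> \<le> L ! i" "L ! i \<le> 1 + \<epsilon>" if "i < r" for i
    using sv[of "Suc i"] that len by (auto simp: singular_value_def L_def)
  have nz: "L ! i \<noteq> 0" if "i < r" for i using Li(1)[OF that] \<epsilon> by auto
  have size: "size (image_mset sqrt (proots (char_poly G))) \<le> r"
    using size_proots_le[of "char_poly G"] mon by simp
  have top: "image_mset sqrt (proots (char_poly G)) = mset (take r L)"
    by (rule leading_nonzero_eigenvalues[OF L size len nz])
  hence "size (image_mset sqrt (proots (char_poly G))) = size (mset (take r L))" by (rule arg_cong)
  hence sz: "size (proots (char_poly G)) = degree (char_poly G)" using len mon by simp
  obtain es where es: "mset es = proots (char_poly G)" using ex_mset by blast
  have cp: "char_poly G = (\<Prod>e\<leftarrow>es. [:- e, 1:])"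
    using monic_split_by_proots[OF _ sz es] mon by blast
  have es_bound: "\<bar>e - (1 + \<epsilon>\<^sup>2)\<bar> \<le> 2 * \<epsilon>" if e: "e \<in> set es" for e
  proof -
    have "sqrt e \<in># image_mset sqrt (proots (char_poly G))" using e es by (metis in_image_mset image_eqI set_mset_mset)
    hence "sqrt e \<in> set (take r L)" by (simp add: top)
    then obtain i where i: "i < r" "sqrt e = L ! i" using len by (auto simp: in_set_conv_nth)
    have b: "1 - \<epsilon> \<le> sqrt e" "sqrt e \<le> 1 + \<epsilon>" using Li[OF i(1)] i(2) by auto
    hence e0: "0 < sqrt e" using \<epsilon> by linarith
    hence "0 \<le> e" by simp
    hence e2: "(sqrt e)\<^sup>2 = e" by simp
    have "(1 - \<epsilon>)\<^sup>2 \<le> (sqrt e)\<^sup>2" "(sqrt e)\<^sup>2 \<le> (1 + \<epsilon>)\<^sup>2" using b \<epsilon> e0 by (intro power_mono; linarith)+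
    thus ?thesis unfolding e2 by (simp add: power2_sum power2_diff abs_le_iff)
  qed
  have symG: "transpose_mat G = G" by (rule eq_matI) (auto simp: G_def mult.commute)
  define u where "u = vec r a"
  have u: "u \<in> carrier_vec r" by (simp add: u_def)
  have uu: "u \<bullet> u = norm2 m w"
  proof -
    have "norm2 m w = (\<Sum>k<m. \<Sum>l<r. \<Sum>l'<r. (a l * a l') * (A $$ (k, l) * A $$ (k, l')))"
      unfolding norm2_def power2_eq_square by (intro sum.cong) (auto simp: w sum_product mult_ac)
    also have "\<dots> = (\<Sum>l<r. \<Sum>k<m. \<Sum>l'<r. (a l * a l') * (A $$ (k, l) * A $$ (k, l')))" by (rule sum.swap)
    also have "\<dots> = (\<Sum>l<r. \<Sum>l'<r. \<Sum>k<m. (a l * a l') * (A $$ (k, l) * A $$ (k, l')))"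
      by (intro sum.cong refl sum.swap)
    also have "\<dots> = (\<Sum>l<r. \<Sum>l'<r. if l' = l then a l * a l' else 0)"
      by (intro sum.cong refl) (auto simp: sum_distrib_left[symmetric] orth)
    also have "\<dots> = (\<Sum>l<r. a l * a l)" by simp
    finally show ?thesis by (simp add: u_def scalar_prod_def lessThan_atLeast0)
  qed
  have Gu: "u \<bullet> (G *\<^sub>v u) = norm2 s (applied (\<lambda>i k. S $$ (i, k)) m w)"
  proof -
    have app: "applied (\<lambda>i k. S $$ (i, k)) m w i = (\<Sum>l<r. a l * C $$ (i, l))" if i: "i < s" for i
    proof -
      have "applied (\<lambda>i k. S $$ (i, k)) m w i = (\<Sum>k<m. \<Sum>l<r. a l * (S $$ (i, k) * A $$ (k, l)))"
        unfolding applied_def by (intro sum.cong) (auto simp: w sum_distrib_left mult_ac)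
      also have "\<dots> = (\<Sum>l<r. \<Sum>k<m. a l * (S $$ (i, k) * A $$ (k, l)))" by (rule sum.swap)
      finally show ?thesis using rn Cent[OF i] by (simp add: sum_distrib_left)
    qed
    have "norm2 s (applied (\<lambda>i k. S $$ (i, k)) m w) = (\<Sum>i<s. \<Sum>l<r. \<Sum>l'<r. a l * ((C $$ (i, l) * C $$ (i, l')) * a l'))"
      unfolding norm2_def power2_eq_square by (intro sum.cong) (auto simp: app sum_product mult_ac)
    also have "\<dots> = (\<Sum>l<r. \<Sum>i<s. \<Sum>l'<r. a l * ((C $$ (i, l) * C $$ (i, l')) * a l'))" by (rule sum.swap)
    also have "\<dots> = (\<Sum>l<r. \<Sum>l'<r. \<Sum>i<s. a l * ((C $$ (i, l) * C $$ (i, l')) * a l'))"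
      by (intro sum.cong refl sum.swap)
    also have "\<dots> = (\<Sum>l<r. a l * (\<Sum>l'<r. (\<Sum>i<s. C $$ (i, l) * C $$ (i, l')) * a l'))"
      by (simp add: sum_distrib_left sum_distrib_right)
    also have "\<dots> = u \<bullet> (G *\<^sub>v u)"
      by (simp add: u_def G_def scalar_prod_def lessThan_atLeast0)
    finally show ?thesis by simp
  qed
  have "\<bar>u \<bullet> (G *\<^sub>v u) - (1 + \<epsilon>\<^sup>2) * (u \<bullet> u)\<bar> \<le> (2 * \<epsilon>) * (u \<bullet> u)"
    by (rule symmetric_quadratic_form_bound[OF G symG cp es_bound _ u]) (use \<epsilon> in auto)
  thus ?thesis unfolding near_isometric_def Gu uu by (simp add: power2_sum power2_diff abs_le_iff algebra_simps)
qed

section \<open>From the random sketch to a fixed matrix\<close>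

lemma rank_orthonormal:
  fixes A :: "real mat"
  assumes A: "A \<in> carrier_mat m n" and rn: "r \<le> n"
    and zero: "\<And>k j. k < m \<Longrightarrow> r \<le> j \<Longrightarrow> j < n \<Longrightarrow> A $$ (k, j) = 0"
    and orth: "\<And>i j. i < r \<Longrightarrow> j < r \<Longrightarrow> (\<Sum>k<m. A $$ (k, i) * A $$ (k, j)) = (if i = j then 1 else 0)"
  shows "vec_space.rank m A = r"
proof -
  interpret vec_space "TYPE(real)" m .
  define U where "U = mat m r (\<lambda>(k, l). A $$ (k, l))"
  have U: "U \<in> carrier_mat m r" by (simp add: U_def)
  have colU: "col U l = col A l" if "l < r" for l
    using that rn A by (intro eq_vecI) (auto simp: U_def)
  have distinct: "distinct (cols U)"
  proof (unfold distinct_conv_nth, intro allI impI)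
    fix i j assume ij: "i < length (cols U)" "j < length (cols U)" "i \<noteq> j"
    hence ij': "i < r" "j < r" using U by auto
    show "cols U ! i \<noteq> cols U ! j"
    proof
      assume "cols U ! i = cols U ! j"
      hence "col A i = col A j" using ij' U colU by (simp add: cols_nth)
      hence "A $$ (k, i) = A $$ (k, j)" if "k < m" for k
        using that ij' rn A by (metis carrier_matD index_col order_less_le_trans)
      hence "(\<Sum>k<m. A $$ (k, i) * A $$ (k, j)) = (\<Sum>k<m. A $$ (k, i) * A $$ (k, i))" by simp
      thus False using orth[of i j] orth[of i i] ij' ij(3) by simp
    qed
  qed
  have indpt: "lin_indpt (set (cols U))"
  proof
    assume "lin_dep (set (cols U))"
    then obtain v where v: "v \<in> carrier_vec r" "v \<noteq> 0\<^sub>v r" "U *\<^sub>v v = 0\<^sub>v m"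
      using lin_depE[OF U _ distinct] by blast
    have "v $ i = 0" if i: "i < r" for i
    proof -
      have z: "(\<Sum>j<r. A $$ (k, j) * v $ j) = 0" if k: "k < m" for k
      proof -
        have "(U *\<^sub>v v) $ k = (\<Sum>j<r. A $$ (k, j) * v $ j)"
          using k v(1) U unfolding U_def by (auto simp: scalar_prod_def lessThan_atLeast0 intro!: sum.cong)
        thus ?thesis using v(3) k by simp
      qed
      have "0 = (\<Sum>k<m. A $$ (k, i) * (\<Sum>j<r. A $$ (k, j) * v $ j))" using z by simp
      also have "\<dots> = (\<Sum>j<r. (\<Sum>k<m. A $$ (k, i) * A $$ (k, j)) * v $ j)"
        unfolding sum_distrib_left sum_distrib_right by (subst sum.swap) (simp add: mult.assoc)
      also have "\<dots> = (\<Sum>j<r. if j = i then v $ j else 0)" using orth[OF i] by (intro sum.cong) auto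
      finally show ?thesis using i by simp
    qed
    hence "v = 0\<^sub>v r" using v(1) by (intro eq_vecI) auto
    thus False using v(2) by simp
  qed
  have sub: "set (cols U) \<subseteq> set (cols A)"
  proof
    fix c assume "c \<in> set (cols U)"
    then obtain l where "l < r" "c = col U l" using U by (auto simp: cols_def)
    thus "c \<in> set (cols A)" using colU[of l] rn A by (auto simp: cols_def)
  qed
  have "maximal (set (cols U)) (\<lambda>T. T \<subseteq> set (cols A) \<and> lin_indpt T)"
    unfolding maximal_def
  proof (intro conjI allI impI sub indpt)
    fix T assume T: "set (cols U) \<subseteq> T \<and> T \<subseteq> set (cols A) \<and> lin_indpt T"
    have "T \<subseteq> set (cols U)"
    proof
      fix c assume c: "c \<in> T"
      then obtain l where l: "l < n" "c = col A l" using T A by (auto simp: cols_def)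
      show "c \<in> set (cols U)"
      proof (cases "l < r")
        case True
        hence "c = cols U ! l" "l < length (cols U)" using l colU[of l] U by (simp_all add: cols_nth)
        thus ?thesis by (simp only: nth_mem)
      next
        case False
        hence "c = 0\<^sub>v m" using l zero A by (intro eq_vecI) auto
        moreover have "0\<^sub>v m \<notin> T"
          using T zero_nin_lin_indpt[of T] A cols_dim[of A] by auto
        ultimately show ?thesis using c by simp
      qed
    qed
    thus "T = set (cols U)" using T by blast
  qed
  hence "rank A = card (set (cols U))" by (rule rank_card_indpt[OF A])
  thus ?thesis using distinct_card[OF distinct] U by simp
qed

lemma space_sketch:
  assumes "sets D = sets (borel_mat s m)"
  shows "space D = carrier_mat s m"
  using sets_eq_imp_space_eq[OF assms] by (simp add: borel_mat_def space_measure_of_conv)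

text \<open>
  The guarantee on singular values is only used for inputs whose nonzero columns are orthonormal; it then says
  that \<open>S\<close> is a near-isometry on a given subspace of dimension at most \<open>r\<close>. The event is
  measurable because a set outside the \<open>\<sigma>\<close>-algebra has measure \<open>0 < 1 - \<delta>\<close>.
\<close>

lemma subspace_event:
  assumes D: "oblivious_sketch \<epsilon> \<delta> r s m n D" and \<epsilon>: "0 < \<epsilon>" "\<epsilon> < 1 / 2" and \<delta>: "\<delta> < 1"
    and r: "r \<le> min m n"
  shows "\<exists>E\<in>sets D. 1 - \<delta> \<le> measure D E \<and>
     (\<forall>S\<in>E. \<forall>w. (\<exists>a. \<forall>k<m. w k = (\<Sum>l<r. a l * u l k)) \<longrightarrow>
        near_isometric \<epsilon> s (\<lambda>i k. S $$ (i, k)) m w)"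
proof -
  obtain q a where q: "\<And>l l'. l < r \<Longrightarrow> l' < r \<Longrightarrow> (\<Sum>k<m. q l k * q l' k) = (if l = l' then 1 else (0::real))"
    and a: "\<And>l k. l < r \<Longrightarrow> k < m \<Longrightarrow> u l k = (\<Sum>l'<r. a l l' * q l' k)"
  proof -
    have "r \<le> m" using r by simp
    from orthonormal_spanning[OF this, of u]
    obtain q a where "(\<forall>l<r. \<forall>l'<r. (\<Sum>k<m. q l k * q l' k) = (if l = l' then 1 else (0::real))) \<and>
       (\<forall>l<r. \<forall>k<m. u l k = (\<Sum>l'<r. a l l' * q l' k))" by (elim exE)
    thus thesis by (intro that[of q a]) simp_all
  qed
  define A where "A = mat m n (\<lambda>(k, j). if j < r then q j k else 0)"
  have A: "A \<in> carrier_mat m n" by (simp add: A_def)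
  have rn: "r \<le> n" using r by simp
  have zero: "A $$ (k, j) = 0" if "k < m" "r \<le> j" "j < n" for k j using that by (simp add: A_def)
  have orth: "(\<Sum>k<m. A $$ (k, i) * A $$ (k, j)) = (if i = j then 1 else 0)" if "i < r" "j < r" for i j
    using q[OF that] that rn by (simp add: A_def)
  define E where "E = {S \<in> space D. preserves_singular_values \<epsilon> r A S}"
  have DD: "sets D = sets (borel_mat s m)" using D by (simp add: oblivious_sketch_def)
  have prob: "1 - \<delta> \<le> measure D E"
    using D A rank_orthonormal[OF A rn zero orth] by (simp add: oblivious_sketch_def E_def)
  hence "measure D E \<noteq> 0" using \<delta> by auto
  hence E: "E \<in> sets D" using measure_notin_sets by blast
  show ?thesis
  proof (intro bexI[OF _ E] conjI prob ballI allI impI)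
    fix S w assume S: "S \<in> E" and "\<exists>a. \<forall>k<m. w k = (\<Sum>l<r. a l * u l k)"
    then obtain c where c: "\<And>k. k < m \<Longrightarrow> w k = (\<Sum>l<r. c l * u l k)" by blast
    have wA: "w k = (\<Sum>l'<r. (\<Sum>l<r. c l * a l l') * A $$ (k, l'))" if k: "k < m" for k
    proof -
      have "w k = (\<Sum>l<r. \<Sum>l'<r. c l * a l l' * q l' k)"
        using c[OF k] a[OF _ k] by (simp add: sum_distrib_left mult.assoc)
      also have "\<dots> = (\<Sum>l'<r. \<Sum>l<r. c l * a l l' * q l' k)" by (rule sum.swap)
      also have "\<dots> = (\<Sum>l'<r. (\<Sum>l<r. c l * a l l') * A $$ (k, l'))"
        using k rn by (intro sum.cong) (auto simp: A_def sum_distrib_right)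
      finally show ?thesis .
    qed
    have "S \<in> carrier_mat s m" "preserves_singular_values \<epsilon> r A S"
      using S space_sketch[OF DD] by (auto simp: E_def)
    thus "near_isometric \<epsilon> s (\<lambda>i k. S $$ (i, k)) m w"
      using near_isometric_of_preserves[where w = w and a = "\<lambda>l'. \<Sum>l<r. c l * a l l'",
          OF _ A rn zero orth _ \<epsilon> wA] by simp
  qed
qed

lemma (in prob_space) exists_above_average:
  assumes \<Omega>: "finite \<Omega>" "\<Omega> \<noteq> {}"
    and E: "\<And>\<omega>. \<omega> \<in> \<Omega> \<Longrightarrow> E \<omega> \<in> events" "\<And>\<omega>. \<omega> \<in> \<Omega> \<Longrightarrow> p \<le> prob (E \<omega>)"
  shows "\<exists>S\<in>space M. p \<le> avg \<Omega> (\<lambda>\<omega>. of_bool (S \<in> E \<omega>))"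
proof (rule ccontr)
  define f where "f = (\<lambda>S. \<Sum>\<omega>\<in>\<Omega>. indicator (E \<omega>) S :: real)"
  assume "\<not> ?thesis"
  hence less: "f S < p * card \<Omega>" if "S \<in> space M" for S
    using that \<Omega> by (force simp: avg_def f_def indicator_def of_bool_def field_simps card_gt_0_iff)
  have int: "integrable M f"
    unfolding f_def using E(1) by (intro Bochner_Integration.integrable_sum integrable_real_indicator) (auto simp: emeasure_eq_measure)
  have "p * card \<Omega> \<le> (\<Sum>\<omega>\<in>\<Omega>. prob (E \<omega>))"
    using sum_mono[of \<Omega> "\<lambda>_. p" "\<lambda>\<omega>. prob (E \<omega>)"] E(2) by (simp add: mult.commute)
  also have "\<dots> = expectation f"
    unfolding f_def using E(1)
    by (subst Bochner_Integration.integral_sum) (auto intro!: integrable_real_indicator simp: emeasure_eq_measure)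
  also have "\<dots> < p * card \<Omega>"
    using expectation_less[OF int, of "p * card \<Omega>"] less by auto
  finally show False by simp
qed

lemma near_isometric_restrict:
  assumes "N \<le> m"
  shows "near_isometric \<epsilon> s S m (\<lambda>k. if k < N then w k else 0) = near_isometric \<epsilon> s S N w"
proof -
  have *: "(\<Sum>k<m. if k < N then f k else 0) = (\<Sum>k<N. f k)" for f :: "nat \<Rightarrow> real"
  proof -
    have "(\<Sum>k<m. if k < N then f k else 0) = (\<Sum>k\<in>{..<m} \<inter> {..<N}. f k)" by (simp add: sum.inter_restrict)
    thus ?thesis using assms by (simp add: Int_absorb1)
  qed
  have "norm2 m (\<lambda>k. if k < N then w k else 0) = norm2 N w"
    unfolding norm2_def using *[of "\<lambda>k. (w k)\<^sup>2"] by (simp add: if_distrib[of "\<lambda>x. x\<^sup>2"] cong: if_cong)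
  moreover have "applied S m (\<lambda>k. if k < N then w k else 0) = applied S N w"
    unfolding applied_def using * by (simp add: fun_eq_iff if_distrib[of "\<lambda>x. _ * x"] cong: if_cong)
  ultimately show ?thesis by (simp add: near_isometric_def)
qed

lemma rows_ge_of_test_events:
  fixes \<epsilon> :: real and b \<rho> s m :: nat and D :: "real mat measure"
  assumes D: "prob_space D"
    and \<epsilon>: "0 < \<epsilon>" "\<epsilon> < 1 / 2" and b: "0 < b" "b * \<epsilon>\<^sup>2 \<le> 1" and \<rho>: "0 < \<rho>"
    and ev: "\<And>W z c. \<exists>E\<in>sets D. 2 / 3 \<le> measure D E \<and>
      (\<forall>S\<in>E. \<forall>w\<in>tests b \<rho> W z c. near_isometric \<epsilon> s (\<lambda>i k. S $$ (i, k)) (\<rho> * b) w)"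
  shows "row_constant * (real \<rho> * real b) \<le> real s"
proof -
  interpret prob_space D by fact
  define \<Omega> where "\<Omega> = sign_pairs (\<rho> * b) \<times> signs (\<rho> * b) \<times> grid"
  have fin: "finite \<Omega>" "\<Omega> \<noteq> {}"
    by (auto simp: \<Omega>_def finite_sign_pairs sign_pairs_nonempty finite_signs signs_nonempty finite_grid grid_nonempty)
  have "\<forall>\<omega>. \<exists>E\<in>sets D. 2 / 3 \<le> measure D E \<and>
      (\<forall>S\<in>E. \<forall>w\<in>(case \<omega> of (W, z, c) \<Rightarrow> tests b \<rho> W z c). near_isometric \<epsilon> s (\<lambda>i k. S $$ (i, k)) (\<rho> * b) w)"
    using ev by auto
  then obtain E where E: "\<And>\<omega>. E \<omega> \<in> sets D" "\<And>\<omega>. 2 / 3 \<le> measure D (E \<omega>)"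
    "\<And>\<omega>. \<forall>S\<in>E \<omega>. \<forall>w\<in>(case \<omega> of (W, z, c) \<Rightarrow> tests b \<rho> W z c). near_isometric \<epsilon> s (\<lambda>i k. S $$ (i, k)) (\<rho> * b) w"
    by metis
  obtain S where S: "2 / 3 \<le> avg \<Omega> (\<lambda>\<omega>. of_bool (S \<in> E \<omega>))"
    using exists_above_average[OF fin, of E "2 / 3"] E(1,2) by blast
  also have "\<dots> \<le> avg \<Omega> (\<lambda>(W, z, c). of_bool (\<forall>w\<in>tests b \<rho> W z c. near_isometric \<epsilon> s (\<lambda>i k. S $$ (i, k)) (\<rho> * b) w))"
  proof (rule avg_mono)
    fix \<omega> show "(of_bool (S \<in> E \<omega>) :: real) \<le> (case \<omega> of (W, z, c) \<Rightarrow>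
        of_bool (\<forall>w\<in>tests b \<rho> W z c. near_isometric \<epsilon> s (\<lambda>i k. S $$ (i, k)) (\<rho> * b) w))"
      using E(3)[of \<omega>] by (cases \<omega>) auto
  qed
  finally show ?thesis
    unfolding \<Omega>_def by (rule rows_ge_of_good_tests[OF \<epsilon> b \<rho>])
qed

text \<open>
  All tests for a given tuple lie in the span of \<open>x_part\<close> and the \<open>r - 1\<close> blocks of \<open>y_part\<close>.
\<close>

lemma rows_ge_rank:
  assumes sk: "oblivious_sketch \<epsilon> \<delta> r s m n D"
    and \<epsilon>: "0 < \<epsilon>" "\<epsilon> < 1 / 2" and \<delta>: "\<delta> < 1 / 3"
    and r: "2 \<le> r" "r \<le> min m n" and b: "0 < b" "b * \<epsilon>\<^sup>2 \<le> 1" "(r - 1) * b \<le> m"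
  shows "row_constant * (real (r - 1) * real b) \<le> real s"
proof (rule rows_ge_of_test_events[OF _ \<epsilon> b(1,2)])
  define \<rho> where "\<rho> = r - 1"
  have r\<rho>: "r = Suc \<rho>" using r by (simp add: \<rho>_def)
  define N where "N = \<rho> * b"
  have Nm: "N \<le> m" using b(3) by (simp add: N_def \<rho>_def)
  show "prob_space D" using sk by (simp add: oblivious_sketch_def)
  show "0 < r - 1" using r by simp
  fix W z c
  define u where "u = (\<lambda>l k. if k < N then (if l < \<rho> then (if k div b = l then y_part W z c k else 0) else x_part W c k) else 0)"
  obtain E where E: "E \<in> sets D" "1 - \<delta> \<le> measure D E"
    "\<And>S w. S \<in> E \<Longrightarrow> (\<exists>a. \<forall>k<m. w k = (\<Sum>l<r. a l * u l k)) \<Longrightarrow> near_isometric \<epsilon> s (\<lambda>i k. S $$ (i, k)) m w"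
    using subspace_event[OF sk \<epsilon> _ r(2), of u] \<delta> by auto
  have span: "\<exists>a. \<forall>k<m. (if k < N then w k else 0) = (\<Sum>l<r. a l * u l k)" if w: "w \<in> tests b \<rho> W z c" for w
  proof -
    have blk: "(\<Sum>l<\<rho>. v l * u l k) = v (k div b) * y_part W z c k" if "k < N" for v k
    proof -
      have "k div b < \<rho>" using that by (simp add: N_def less_mult_imp_div_less)
      moreover have "(\<Sum>l<\<rho>. v l * u l k) = (\<Sum>l<\<rho>. if l = k div b then v l * y_part W z c k else 0)"
        using that by (intro sum.cong) (auto simp: u_def)
      ultimately show ?thesis by simp
    qed
    from w consider v where "w = flipped_test b W z c v" | j where "w = block_test b W z c j"
      by (auto simp: tests_def split: if_splits)
    thus ?thesis
    proof cases
      case 1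
      have "(if k < N then w k else 0) = (\<Sum>l<r. (if l < \<rho> then v l else 1) * u l k)" for k
      proof -
        have "(\<Sum>l<\<rho>. (if l < \<rho> then v l else 1) * u l k) = (\<Sum>l<\<rho>. v l * u l k)" by (intro sum.cong) auto
        thus ?thesis using blk[of k v] by (auto simp: r\<rho> 1 flipped_test_def u_def)
      qed
      thus ?thesis by (intro exI[of _ "\<lambda>l. if l < \<rho> then v l else 1"] allI impI)
    next
      case 2
      define v where "v = (\<lambda>l. if l = j then 1 else (0::real))"
      have "(if k < N then w k else 0) = (\<Sum>l<r. (if l < \<rho> then v l else 0) * u l k)" for k
      proof -
        have "(\<Sum>l<\<rho>. (if l < \<rho> then v l else 0) * u l k) = (\<Sum>l<\<rho>. v l * u l k)" by (intro sum.cong) auto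
        thus ?thesis using blk[of k v] by (auto simp: r\<rho> 2 block_test_def u_def v_def)
      qed
      thus ?thesis by (intro exI[of _ "\<lambda>l. if l < \<rho> then v l else 0"] allI impI)
    qed
  qed
  have "near_isometric \<epsilon> s (\<lambda>i k. S $$ (i, k)) N w" if "S \<in> E" "w \<in> tests b \<rho> W z c" for S w
    using E(3)[OF that(1) span[OF that(2)]] by (simp add: near_isometric_restrict[OF Nm])
  thus "\<exists>E\<in>sets D. 2 / 3 \<le> measure D E \<and>
      (\<forall>S\<in>E. \<forall>w\<in>tests b (r - 1) W z c. near_isometric \<epsilon> s (\<lambda>i k. S $$ (i, k)) ((r - 1) * b) w)"
    using E(1,2) \<delta> unfolding N_def \<rho>_def by (intro bexI[of _ E]) auto
qed

lemma (in prob_space) prob_Inter_ge: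
  fixes p :: real
  assumes "finite I" "\<And>i. i \<in> I \<Longrightarrow> E i \<in> events" "\<And>i. i \<in> I \<Longrightarrow> 1 - p \<le> prob (E i)"
  shows "space M \<inter> (\<Inter>i\<in>I. E i) \<in> events \<and> 1 - card I * p \<le> prob (space M \<inter> (\<Inter>i\<in>I. E i))"
  using assms
proof (induction I rule: finite_induct)
  case empty
  show ?case by (simp add: prob_space)
next
  case (insert i I)
  define F where "F = space M \<inter> (\<Inter>i\<in>I. E i)"
  have F: "F \<in> events" "1 - card I * p \<le> prob F" using insert by (auto simp: F_def)
  have Ei: "E i \<in> events" "1 - p \<le> prob (E i)" using insert by auto
  have eq: "space M \<inter> (\<Inter>i\<in>insert i I. E i) = E i \<inter> F" by (auto simp: F_def)
  have "prob (E i) \<le> prob (E i \<inter> F) + prob (space M - F)"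
  proof -
    have "prob (E i) \<le> prob ((E i \<inter> F) \<union> (space M - F))"
      using F Ei sets.sets_into_space by (intro finite_measure_mono) auto
    also have "\<dots> \<le> prob (E i \<inter> F) + prob (space M - F)"
      using F Ei by (intro measure_Un_le) auto
    finally show ?thesis .
  qed
  also have "prob (space M - F) = 1 - prob F" using F by (intro prob_compl)
  finally have "1 - card (insert i I) * p \<le> prob (E i \<inter> F)"
    using F Ei insert.hyps by (simp add: algebra_simps)
  thus ?case unfolding eq using F Ei by auto
qed

lemma card_tests: "0 < \<rho> \<Longrightarrow> finite (tests b \<rho> W z c) \<and> card (tests b \<rho> W z c) \<le> 4 ^ (\<rho> - 1)"
proof -
  assume \<rho>: "0 < \<rho>"
  define n where "n = \<rho> - 1"
  have \<rho>n: "\<rho> = Suc n" using \<rho> by (simp add: n_def)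
  have finf: "finite (flips \<rho>)" by (auto simp: flips_def intro!: finite_PiE)
  have "card (tests b \<rho> W z c) \<le> card (flipped_test b W z c ` flips \<rho>)
      + card (if 2 \<le> \<rho> then block_test b W z c ` {..<\<rho>} else {})"
    unfolding tests_def by (rule card_Un_le)
  also have "\<dots> \<le> 2 ^ n + (if 2 \<le> \<rho> then \<rho> else 0)"
    using card_image_le[OF finf, of "flipped_test b W z c"] card_image_le[of "{..<\<rho>}" "block_test b W z c"] card_flips[OF \<rho>]
    by (auto simp: n_def)
  also have "\<dots> \<le> 4 ^ n"
  proof (cases "n = 0")
    case False
    then obtain k where k: "n = Suc k" by (cases n) auto
    have "Suc n \<le> 2 ^ n" by (rule Suc_leI) (rule less_exp)
    hence "2 ^ n + (if 2 \<le> \<rho> then \<rho> else 0) \<le> 2 ^ n + 2 ^ n" by (simp add: \<rho>n)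
    also have "\<dots> = 4 * 2 ^ k" by (simp add: k)
    also have "\<dots> \<le> 4 * 4 ^ k" by (intro mult_left_mono power_mono) auto
    finally show ?thesis by (simp add: k)
  qed (simp add: \<rho>n)
  finally show ?thesis using finf by (simp add: tests_def n_def)
qed

text \<open>
  Each test vector lies in a subspace of dimension \<open>1 \<le> r\<close>, hence fails with probability at most
  \<open>\<delta>\<close>.
\<close>

lemma rows_ge_confidence:
  assumes sk: "oblivious_sketch \<epsilon> \<delta> r s m n D"
    and \<epsilon>: "0 < \<epsilon>" "\<epsilon> < 1 / 2" and \<delta>: "0 < \<delta>" "4 ^ (\<rho> - 1) * \<delta> \<le> 1 / 3"
    and r: "1 \<le> r" "r \<le> min m n" and b: "0 < b" "b * \<epsilon>\<^sup>2 \<le> 1" "\<rho> * b \<le> m" and \<rho>: "0 < \<rho>"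
  shows "row_constant * (real \<rho> * real b) \<le> real s"
proof (rule rows_ge_of_test_events[OF _ \<epsilon> b(1,2) \<rho>])
  show pD: "prob_space D" using sk by (simp add: oblivious_sketch_def)
  interpret prob_space D by fact
  fix W z c
  define N where "N = \<rho> * b"
  have "1 * \<delta> \<le> 4 ^ (\<rho> - 1) * \<delta>" using \<delta>(1) by (intro mult_right_mono) auto
  hence \<delta>1: "\<delta> < 1" using \<delta>(2) by simp
  have "\<exists>E\<in>sets D. 1 - \<delta> \<le> prob E \<and> (\<forall>S\<in>E. near_isometric \<epsilon> s (\<lambda>i k. S $$ (i, k)) N w)" for w
  proof -
    define w' where "w' = (\<lambda>k. if k < N then w k else 0)"
    have "w' k = (\<Sum>l<r. (if l = 0 then 1 else 0) * w' k)" for k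
    proof -
      have "(\<Sum>l<r. (if l = 0 then 1 else 0) * w' k) = (\<Sum>l<r. if l = 0 then w' k else 0)"
        by (intro sum.cong) auto
      thus ?thesis using r(1) by simp
    qed
    hence "\<exists>a. \<forall>k<m. w' k = (\<Sum>l<r. a l * w' k)" by (intro exI[of _ "\<lambda>l. if l = 0 then 1 else 0"]) blast
    moreover have "near_isometric \<epsilon> s (\<lambda>i k. S $$ (i, k)) m w' = near_isometric \<epsilon> s (\<lambda>i k. S $$ (i, k)) N w" for S :: "real mat"
      unfolding w'_def using b(3) by (intro near_isometric_restrict) (simp add: N_def)
    ultimately show ?thesis using subspace_event[OF sk \<epsilon> \<delta>1 r(2), of "\<lambda>_. w'"] by blast
  qed
  then obtain E where E: "\<And>w. E w \<in> sets D" "\<And>w. 1 - \<delta> \<le> prob (E w)"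
    "\<And>w S. S \<in> E w \<Longrightarrow> near_isometric \<epsilon> s (\<lambda>i k. S $$ (i, k)) N w" by metis
  define F where "F = space D \<inter> (\<Inter>w\<in>tests b \<rho> W z c. E w)"
  note ct = card_tests[OF \<rho>, of b W z c]
  have F: "F \<in> sets D" "1 - card (tests b \<rho> W z c) * \<delta> \<le> prob F"
    using prob_Inter_ge[of "tests b \<rho> W z c" E \<delta>] ct E(1,2) by (auto simp: F_def)
  have "real (card (tests b \<rho> W z c)) \<le> real (4 ^ (\<rho> - 1))" using ct by (intro of_nat_mono) simp
  hence "card (tests b \<rho> W z c) * \<delta> \<le> 4 ^ (\<rho> - 1) * \<delta>" using \<delta>(1) by (intro mult_right_mono) auto
  hence "2 / 3 \<le> prob F" using F(2) \<delta>(2) by linarith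
  moreover have "\<forall>S\<in>F. \<forall>w\<in>tests b \<rho> W z c. near_isometric \<epsilon> s (\<lambda>i k. S $$ (i, k)) (\<rho> * b) w"
    using E(3) by (auto simp: F_def N_def)
  ultimately show "\<exists>E\<in>sets D. 2 / 3 \<le> measure D E \<and>
      (\<forall>S\<in>E. \<forall>w\<in>tests b \<rho> W z c. near_isometric \<epsilon> s (\<lambda>i k. S $$ (i, k)) (\<rho> * b) w)"
    using F(1) by blast
qed

lemma row_constant_pos: "0 < row_constant"
  by (simp add: row_constant_def energy_constant_def defect_constant_def)

text \<open>
  The confidence term dominates when \<open>r = 1\<close>, as \<open>ln (1 / \<delta>) > ln 3 > 1\<close>; so the bound by the
  rank is needed only for \<open>r \<ge> 2\<close>, where \<open>r - 1 \<ge> r / 2\<close>.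
\<close>

lemma rows_lower_bound:
  fixes \<epsilon> \<delta> :: real and r s m n :: nat
  assumes \<epsilon>: "0 < \<epsilon>" "\<epsilon> < 1 / 2" and \<delta>: "0 < \<delta>" "\<delta> < 1 / 3"
    and r: "1 \<le> r" "r \<le> min m n" and m: "(real r + ln (1 / \<delta>)) / \<epsilon>\<^sup>2 \<le> real m"
    and sk: "oblivious_sketch \<epsilon> \<delta> r s m n D"
  shows "row_constant / 20 * ((real r + ln (1 / \<delta>)) / \<epsilon>\<^sup>2) \<le> real s"
proof -
  define L where "L = ln (1 / \<delta>)"
  define I where "I = 1 / \<epsilon>\<^sup>2"
  define b where "b = nat \<lfloor>I\<rfloor>"
  have \<epsilon>2: "0 < \<epsilon>\<^sup>2" "\<epsilon>\<^sup>2 < 1 / 4"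
    using \<epsilon> power_strict_mono[of \<epsilon> "1 / 2" 2] by (auto simp: power2_eq_square)
  have I: "4 < I" using \<epsilon>2 by (simp add: I_def field_simps)
  have b: "real b \<le> I" "I / 2 \<le> real b" "0 < b"
    using I by (auto simp: b_def) linarith+
  have b\<epsilon>: "b * \<epsilon>\<^sup>2 \<le> 1" using b(1) \<epsilon>2 by (simp add: I_def field_simps)
  have m': "(r + L) * I \<le> m" using m by (simp add: L_def I_def)
  have rc: "0 < row_constant" by (rule row_constant_pos)
  have "exp 1 < (3::real)" using e_less_272 by simp
  hence "ln (exp 1) < ln (3::real)" by (subst ln_less_cancel_iff) auto
  hence ln3: "1 < ln (3::real)" by simp
  have ln3': "ln (3::real) \<le> 2" using ln_le_minus_one[of "3::real"] by simp
  have "ln (3::real) < ln 4" by (subst ln_less_cancel_iff) auto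
  hence ln4: "1 < ln (4::real)" "ln (4::real) \<le> 3"
    using ln3 ln_le_minus_one[of "4::real"] by linarith+
  have L: "ln 3 < L" unfolding L_def using \<delta> by (subst ln_less_cancel_iff) (auto simp: field_simps)
  have confidence: "row_constant * (L * I) \<le> 10 * s"
  proof -
    \<comment> \<open>the largest \<open>n\<close> with \<open>4\<^sup>n \<delta> \<le> 1/3\<close>; the number of blocks is \<open>n + 1\<close>\<close>
    define n where "n = nat \<lfloor>(L - ln 3) / ln 4\<rfloor>"
    have n0: "0 \<le> (L - ln 3) / ln 4" using L ln4 by simp
    hence n: "real n \<le> (L - ln 3) / ln 4" "(L - ln 3) / ln 4 < n + 1" by (auto simp: n_def) linarith
    have n1: "n * ln 4 \<le> L - ln 3" using n(1) ln4 by (simp add: field_simps)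
    have n2: "L \<le> ln 3 + (n + 1) * ln 4" using n(2) ln4 by (simp add: field_simps)
    have "(4::real) ^ n = exp (n * ln 4)" by (simp add: exp_of_nat_mult)
    also have "\<dots> \<le> exp (L - ln 3)" using n1 by simp
    also have "\<dots> = 1 / (3 * \<delta>)" using \<delta> by (simp add: exp_diff L_def)
    finally have "4 ^ n * \<delta> \<le> 1 / 3" using \<delta> by (simp add: field_simps)
    moreover have "Suc n * b \<le> m"
    proof -
      have "n \<le> n * ln 4" using mult_left_mono[of 1 "ln 4" "real n"] ln4 by simp
      hence "n \<le> L" using n1 ln3 by linarith
      hence "real (Suc n) * b \<le> (r + L) * I" using r b I by (intro mult_mono) auto
      thus ?thesis using m' by (metis of_nat_le_iff of_nat_mult order_trans)
    qed
    ultimately have s: "row_constant * (real (Suc n) * real b) \<le> real s"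
      using rows_ge_confidence[OF sk \<epsilon> \<delta>(1) _ r b(3) b\<epsilon>, of "Suc n"] by simp
    have "L \<le> 2 + (n + 1) * 3"
    proof -
      have "real (n + 1) * ln 4 \<le> real (n + 1) * 3" using ln4(2) by (intro mult_left_mono) auto
      hence "L \<le> 2 + real (n + 1) * 3" using n2 ln3' by linarith
      thus ?thesis by simp
    qed
    hence "L \<le> 5 * real (Suc n)" by simp
    hence "L * I \<le> (5 * real (Suc n)) * (2 * real b)" using b(2) I by (intro mult_mono) auto
    hence "row_constant * (L * I) \<le> row_constant * ((5 * real (Suc n)) * (2 * real b))" using rc by (intro mult_left_mono) auto
    also have "\<dots> = 10 * (row_constant * (real (Suc n) * real b))" by (simp only: mult_ac)
    also have "\<dots> \<le> 10 * s" using s by simp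
    finally show ?thesis .
  qed
  have "row_constant * ((r + L) * I) \<le> 20 * s"
  proof (cases "r = 1")
    case True
    have "(r + L) * I \<le> (2 * L) * I" using True L ln3 I by (intro mult_right_mono) auto
    hence "row_constant * ((r + L) * I) \<le> row_constant * ((2 * L) * I)" using rc by (intro mult_left_mono) auto
    thus ?thesis using confidence by simp
  next
    case False
    hence r2: "2 \<le> r" using r by simp
    have "real (r - 1) * b \<le> (r + L) * I" using r b I L ln3 by (intro mult_mono) auto
    hence "(r - 1) * b \<le> m" using m' by (metis of_nat_le_iff of_nat_mult order_trans)
    hence s: "row_constant * (real (r - 1) * real b) \<le> real s"
      by (rule rows_ge_rank[OF sk \<epsilon> \<delta>(2) r2 r(2) b(3) b\<epsilon>])
    have "r * I \<le> (2 * real (r - 1)) * (2 * real b)" using r2 b(2) I by (intro mult_mono) auto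
    hence "row_constant * (r * I) \<le> row_constant * ((2 * real (r - 1)) * (2 * real b))" using rc by (intro mult_left_mono) auto
    also have "\<dots> = 4 * (row_constant * (real (r - 1) * real b))" by (simp only: mult_ac)
    also have "\<dots> \<le> 4 * s" using s by simp
    finally have "row_constant * (r * I) \<le> 4 * s" .
    hence "row_constant * (r * I) + row_constant * (L * I) \<le> 14 * s" using confidence by simp
    moreover have "row_constant * ((r + L) * I) = row_constant * (r * I) + row_constant * (L * I)" by (simp add: algebra_simps)
    ultimately show ?thesis by simp
  qed
  thus ?thesis by (simp add: L_def I_def)
qed

theorem theorem3:
  shows "(\<exists>c\<^sub>0 :: real. c\<^sub>0 > 0 \<and>
            (\<forall>(\<epsilon> :: real) (\<delta> :: real) (r :: nat) (s :: nat) (m :: nat) (n :: nat) (D :: real mat measure).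
               0 < \<epsilon> \<longrightarrow> \<epsilon> < 1 / 2 \<longrightarrow> 0 < \<delta> \<longrightarrow> \<delta> < 1 / 3 \<longrightarrow>
               1 \<le> r \<longrightarrow> r \<le> min m n \<longrightarrow>
               (real r + ln (1 / \<delta>)) / \<epsilon>\<^sup>2 \<le> real m \<longrightarrow>
               oblivious_sketch \<epsilon> \<delta> r s m n D \<longrightarrow>
               real s \<ge> c\<^sub>0 * ((real r + ln (1 / \<delta>)) / \<epsilon>\<^sup>2)))
       \<and>
         (\<forall>(\<delta> :: real) (\<epsilon> :: nat \<Rightarrow> real) (r :: nat \<Rightarrow> nat) (s :: nat \<Rightarrow> nat)
            (m :: nat \<Rightarrow> nat) (n :: nat \<Rightarrow> nat).
            0 < \<delta> \<longrightarrow> \<delta> < 1 / 3 \<longrightarrow>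
            (\<forall>k. 0 < \<epsilon> k \<and> \<epsilon> k < 1 / 2 \<and> 1 \<le> r k \<and> r k \<le> min (m k) (n k) \<and>
                 (real (r k) + ln (1 / \<delta>)) / (\<epsilon> k)\<^sup>2 \<le> real (m k)) \<longrightarrow>
            (\<lambda>k. real (s k)) \<in> o(\<lambda>k. real (r k) / (\<epsilon> k)\<^sup>2) \<longrightarrow>
            (\<forall>\<^sub>F k in sequentially.
               \<not> (\<exists>D. oblivious_sketch (\<epsilon> k) \<delta> (r k) (s k) (m k) (n k) D)))"
proof (intro conjI allI impI)
  show "\<exists>c\<^sub>0 :: real. c\<^sub>0 > 0 \<and>
            (\<forall>(\<epsilon> :: real) (\<delta> :: real) (r :: nat) (s :: nat) (m :: nat) (n :: nat) (D :: real mat measure).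
               0 < \<epsilon> \<longrightarrow> \<epsilon> < 1 / 2 \<longrightarrow> 0 < \<delta> \<longrightarrow> \<delta> < 1 / 3 \<longrightarrow>
               1 \<le> r \<longrightarrow> r \<le> min m n \<longrightarrow>
               (real r + ln (1 / \<delta>)) / \<epsilon>\<^sup>2 \<le> real m \<longrightarrow>
               oblivious_sketch \<epsilon> \<delta> r s m n D \<longrightarrow>
               real s \<ge> c\<^sub>0 * ((real r + ln (1 / \<delta>)) / \<epsilon>\<^sup>2))"
    using row_constant_pos rows_lower_bound by (intro exI[of _ "row_constant / 20"]) simp
next
  fix \<delta> :: real and \<epsilon> :: "nat \<Rightarrow> real" and r s m n :: "nat \<Rightarrow> nat"
  assume \<delta>: "0 < \<delta>" "\<delta> < 1 / 3"
    and par: "\<forall>k. 0 < \<epsilon> k \<and> \<epsilon> k < 1 / 2 \<and> 1 \<le> r k \<and> r k \<le> min (m k) (n k) \<and>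
                 (real (r k) + ln (1 / \<delta>)) / (\<epsilon> k)\<^sup>2 \<le> real (m k)"
    and small: "(\<lambda>k. real (s k)) \<in> o(\<lambda>k. real (r k) / (\<epsilon> k)\<^sup>2)"
  have "\<forall>\<^sub>F k in sequentially. norm (real (s k)) \<le> row_constant / 40 * norm (real (r k) / (\<epsilon> k)\<^sup>2)"
    using small row_constant_pos by (intro landau_o.smallD) auto
  thus "\<forall>\<^sub>F k in sequentially. \<not> (\<exists>D. oblivious_sketch (\<epsilon> k) \<delta> (r k) (s k) (m k) (n k) D)"
  proof eventually_elim
    case (elim k)
    show ?case
    proof
      assume "\<exists>D. oblivious_sketch (\<epsilon> k) \<delta> (r k) (s k) (m k) (n k) D"
      then obtain D where "oblivious_sketch (\<epsilon> k) \<delta> (r k) (s k) (m k) (n k) D" by blast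
      hence "row_constant / 20 * ((real (r k) + ln (1 / \<delta>)) / (\<epsilon> k)\<^sup>2) \<le> real (s k)"
        using par \<delta> by (intro rows_lower_bound) auto
      moreover have "real (r k) / (\<epsilon> k)\<^sup>2 \<le> (real (r k) + ln (1 / \<delta>)) / (\<epsilon> k)\<^sup>2"
        using \<delta> by (intro divide_right_mono) auto
      hence "row_constant / 20 * (real (r k) / (\<epsilon> k)\<^sup>2) \<le> row_constant / 20 * ((real (r k) + ln (1 / \<delta>)) / (\<epsilon> k)\<^sup>2)"
        using row_constant_pos by (intro mult_left_mono) auto
      moreover have "0 < row_constant * (real (r k) / (\<epsilon> k)\<^sup>2)"
        using row_constant_pos par[rule_format, of k] by (intro mult_pos_pos divide_pos_pos) auto
      ultimately show False using elim by simp
    qed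
  qed
qed

end
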